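(* Let $K$ be a field, let $A=\{\mathbf{t}^{\mathbf{a}_1},\ldots,\mathbf{t}^{\mathbf{a}_n}\}$ be a configuration of $K[t_1,\ldots,t_d]$ all of whose monomials have the same total degree $r$ and such that every variable $t_i$ divides at least one monomial of $A$, and for each $1\le i\le d$ let $B_i=\{m^{(i)}_1,\ldots,m^{(i)}_{\lambda_i}\}$ be a set of variables (so that $K[B_i]$ is a polynomial ring), the sets $B_1,\ldots,B_d$ being pairwise disjoint. Let $\mathcal{G}_0$ be a Gröbner basis of $I_A\subset K[y_1,\ldots,y_n]$ consisting of binomials, with respect to a monomial order $<_0$. Then there is a monomial order on $K[\mathbf{x}]$ with respect to which $I_{A(B_1,\ldots,B_d)}$ has a Gröbner basis consisting of all the following binomials, the initial monomial of each being its first (underlined) monomial: (1) $$\underline{\prod_{\ell=1}^p x^{(k_\ell)}_{(i_{(\ell-1)r+1},j_{(\ell-1)r+1})\cdots(i_{\ell r},j_{\ell r})}}-\prod_{\ell=1}^p x^{(k'_\ell)}_{(i'_{(\ell-1)r+1},j'_{(\ell-1)r+1})\cdots(i'_{\ell r},j'_{\ell r})},$$ where $\underline{y_{k_1}\cdots y_{k_p}}-y_{k'_1}\cdots y_{k'_p}\in\mathcal{G}_0$ (with initial monomial underlined) and $\mathrm{sort}((i_1,j_1)\cdots(i_{pr},j_{pr}))=\mathrm{sort}((i'_1,j'_1)\cdots(i'_{pr},j'_{pr}))$. (2) $$\underline{x^{(k)}_{(i_1,j_1)\cdots(i_r,j_r)}\,x^{(k)}_{(i_{r+1},j_{r+1})\cdots(i_{2r},j_{2r})}}-x^{(k)}_{(i'_1,j'_1)(i'_3,j'_3)\cdots(i'_{2r-1},j'_{2r-1})}\,x^{(k)}_{(i'_2,j'_2)(i'_4,j'_4)\cdots(i'_{2r},j'_{2r})},$$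 where $\mathrm{sort}((i_1,j_1)\cdots(i_{2r},j_{2r}))=(i'_1,j'_1)\cdots(i'_{2r},j'_{2r})$. (3) $$\underline{x^{(k)}_{(i_1,j_1)\cdots(i_\ell,j_\ell)\cdots(i_r,j_r)}\,x^{(k')}_{(i'_1,j'_1)\cdots(i'_{\ell'},j'_{\ell'})\cdots(i'_r,j'_r)}}-x^{(k)}_{(i_1,j_1)\cdots(i'_{\ell'},j'_{\ell'})\cdots(i_r,j_r)}\,x^{(k')}_{(i'_1,j'_1)\cdots(i_\ell,j_\ell)\cdots(i'_r,j'_r)},$$ where $k<k'$, $i_\ell=i'_{\ell'}$ and $j_\ell>j'_{\ell'}$ (the two letters $(i_\ell,j_\ell)$ and $(i'_{\ell'},j'_{\ell'})$ are interchanged). In particular, the initial monomial of each binomial in (2) and (3) is squarefree. Moreover, the initial monomial of each binomial in (1) is squarefree (resp. quadratic) if the corresponding monomial $y_{k_1}\cdots y_{k_p}$ is squarefree (resp. quadratic).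
   Context: A configuration of a polynomial ring $K[t_1,\ldots,t_d]$ is a finite set $A=\{\mathbf{t}^{\mathbf{a}_1},\ldots,\mathbf{t}^{\mathbf{a}_n}\}$ of (distinct) monomials such that there is $\mathbf{w}\in\mathbb{R}^d$ with $\mathbf{w}\cdot\mathbf{a}_i=1$ for all $i$. The toric ideal $I_A\subset K[y_1,\ldots,y_n]$ is the kernel of $y_k\mapsto\mathbf{t}^{\mathbf{a}_k}$. Nested configuration: $$A(B_1,\ldots,B_d)=\{m^{(i_1)}_{j_1}\cdots m^{(i_r)}_{j_r} : t_{i_1}\cdots t_{i_r}\in A,\ 1\le j_k\le\lambda_{i_k}\text{ for }1\le k\le r\},$$ a set of monomials in the polynomial ring on the (disjoint) sets of variables $B_1,\ldots,B_d$. Variables of $K[\mathbf{x}]$: there is one variable for each element of $A(B_1,\ldots,B_d)$. For letters $(i_1,j_1),\ldots,(i_r,j_r)$ with $1\le i_s\le d$, $1\le j_s\le\lambda_{i_s}$ and $t_{i_1}\cdots t_{i_r}=\mathbf{t}^{\mathbf{a}_k}\in A$, the variable corresponding to $m^{(i_1)}_{j_1}\cdots m^{(i_r)}_{j_r}$ is denoted $x^{(k)}_{(i_1,j_1)\cdots(i_r,j_r)}$; the order in which the letters are written in the label is immaterial (one may always write them with $i_1\le\cdots\le i_r$). The symbols in the binomials are required to be such variables. The toric ideal $I_{A(B_1,\ldots,B_d)}$ is the kernel of $K[\mathbf{x}]\to K[\mathbf{u}^{(1)},\ldots,\mathbf{u}^{(d)}]$, $x^{(k)}_{(i_1,j_1)\cdots(i_r,j_r)}\mapsto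 m^{(i_1)}_{j_1}\cdots m^{(i_r)}_{j_r}$, where $\mathbf{u}^{(i)}$ denotes the variables in $B_i$. Sorting: $\mathrm{sort}$ takes a string of letters over the alphabet $\{(i,j):1\le i\le d,\ 1\le j\le\lambda_i\}$ and rearranges it in the order $(1,1)\succ(1,2)\succ\cdots\succ(1,\lambda_1)\succ(2,1)\succ\cdots\succ(d,\lambda_d)$, $(1,1)$ coming first. Expressions of type (2) in which the two monomials coincide (giving $0$) are discarded. A binomial is a difference of two monomials. *)

theory Defs
  imports Complex_Main "HOL-Library.Poly_Mapping" "HOL-Library.Product_Lexorder"
    "HOL-Library.Disjoint_Sets"
begin

text \<open>Monomials are written additively, as exponent vectors.\<close>

type_synonym 'v monomial = "'v \<Rightarrow>\<^sub>0 nat"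
type_synonym ('v, 'k) mpoly = "'v monomial \<Rightarrow>\<^sub>0 'k"

definition monom_poly :: "'v monomial \<Rightarrow> ('v, 'k::field) mpoly" where
  "monom_poly u = Poly_Mapping.single u 1"

definition mdeg :: "'v monomial \<Rightarrow> nat" where
  "mdeg u = (\<Sum>v\<in>Poly_Mapping.keys u. Poly_Mapping.lookup u v)"

definition squarefree_monomial :: "'v monomial \<Rightarrow> bool" where
  "squarefree_monomial u \<longleftrightarrow> (\<forall>v. Poly_Mapping.lookup u v \<le> 1)"

definition quadratic_monomial :: "'v monomial \<Rightarrow> bool" where
  "quadratic_monomial u \<longleftrightarrow> mdeg u = 2"

definition monomials :: "'v set \<Rightarrow> 'v monomial set" where
  "monomials X = {u. Poly_Mapping.keys u \<subseteq> X}"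

text \<open>The polynomial ring in the variables \<open>X\<close>, inside the polynomials over all of \<open>'v\<close>.\<close>

definition poly_ring :: "'v set \<Rightarrow> ('v, 'k::field) mpoly set" where
  "poly_ring X = {p. Poly_Mapping.keys p \<subseteq> monomials X}"

definition poly_subst :: "('v \<Rightarrow> ('w, 'k) mpoly) \<Rightarrow> ('v, 'k::field) mpoly \<Rightarrow> ('w, 'k) mpoly" where
  "poly_subst f p =
     (\<Sum>u\<in>Poly_Mapping.keys p. Poly_Mapping.single 0 (Poly_Mapping.lookup p u) *
        (\<Prod>v\<in>Poly_Mapping.keys u. f v ^ Poly_Mapping.lookup u v))"

definition toric_ideal :: "'v set \<Rightarrow> ('v \<Rightarrow> 'w monomial) \<Rightarrow> ('v, 'k::field) mpoly set" where
  "toric_ideal X \<phi> = {p \<in> poly_ring X. poly_subst (\<lambda>v. monom_poly (\<phi> v)) p = 0}"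

definition ideal_generated :: "'v set \<Rightarrow> ('v, 'k::field) mpoly set \<Rightarrow> ('v, 'k) mpoly set" where
  "ideal_generated X S =
     {\<Sum>s\<in>T. c s * s |T c. finite T \<and> T \<subseteq> S \<and> (\<forall>s\<in>T. c s \<in> poly_ring X)}"

text \<open>Monomial orders are given by their strict part; values outside \<open>monomials X\<close> are irrelevant.\<close>

definition monomial_order :: "'v set \<Rightarrow> ('v monomial \<Rightarrow> 'v monomial \<Rightarrow> bool) \<Rightarrow> bool" where
  "monomial_order X lt \<longleftrightarrow>
     irreflp_on (monomials X) lt \<and> transp_on (monomials X) lt \<and> totalp_on (monomials X) lt \<and>
     (\<forall>u\<in>monomials X. u \<noteq> 0 \<longrightarrow> lt 0 u) \<and>
     (\<forall>u\<in>monomials X. \<forall>v\<in>monomials X. \<forall>w\<in>monomials X. lt u v \<longrightarrow> lt (u + w) (v + w))"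

definition initial_monomial ::
    "('v monomial \<Rightarrow> 'v monomial \<Rightarrow> bool) \<Rightarrow> ('v, 'k::field) mpoly \<Rightarrow> 'v monomial" where
  "initial_monomial lt p =
     (THE u. u \<in> Poly_Mapping.keys p \<and> (\<forall>v\<in>Poly_Mapping.keys p. v \<noteq> u \<longrightarrow> lt v u))"

definition groebner_basis ::
    "'v set \<Rightarrow> ('v monomial \<Rightarrow> 'v monomial \<Rightarrow> bool) \<Rightarrow>
     ('v, 'k::field) mpoly set \<Rightarrow> ('v, 'k) mpoly set \<Rightarrow> bool" where
  "groebner_basis X lt I G \<longleftrightarrow>
     finite G \<and> G \<subseteq> I \<and> 0 \<notin> G \<and>
     ideal_generated X ((\<lambda>g. monom_poly (initial_monomial lt g)) ` G) =
     (ideal_generated X ((\<lambda>f. monom_poly (initial_monomial lt f)) ` (I - {0})) :: ('v, 'k) mpoly set)"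

definition binomial_poly :: "'v monomial \<Rightarrow> 'v monomial \<Rightarrow> ('v, 'k::field) mpoly" where
  "binomial_poly u v = monom_poly u - monom_poly v"

definition is_binomial :: "('v, 'k::field) mpoly \<Rightarrow> bool" where
  "is_binomial p \<longleftrightarrow> (\<exists>u v. u \<noteq> v \<and> p = binomial_poly u v)"

definition configuration :: "nat \<Rightarrow> nat \<Rightarrow> (nat \<Rightarrow> nat monomial) \<Rightarrow> bool" where
  "configuration d n a \<longleftrightarrow>
     inj_on a {1..n} \<and> (\<forall>k\<in>{1..n}. a k \<in> monomials {1..d}) \<and>
     (\<exists>w :: nat \<Rightarrow> real. \<forall>k\<in>{1..n}. (\<Sum>i=1..d. w i * real (Poly_Mapping.lookup (a k) i)) = 1)"

text \<open>
  Letters \<open>(i, j)\<close> are ordered lexicographically, so that \<^const>\<open>sort\<close> puts \<open>(1, 1)\<close> first.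
  In the following, \<open>\<lambda>\<^sub>i\<close> is \<open>lam i\<close> and the variable \<open>m\<^sup>(\<^sup>i\<^sup>)\<^sub>j\<close> of \<open>B\<^sub>i\<close> is \<open>m i j\<close>.
\<close>

definition letters :: "nat \<Rightarrow> (nat \<Rightarrow> nat) \<Rightarrow> (nat \<times> nat) set" where
  "letters d lam = Sigma {1..d} (\<lambda>i. {1..lam i})"

definition t_monomial :: "(nat \<times> nat) list \<Rightarrow> nat monomial" where
  "t_monomial w = (\<Sum>(i, j)\<leftarrow>w. Poly_Mapping.single i 1)"

definition u_monomial :: "(nat \<Rightarrow> nat \<Rightarrow> 'u) \<Rightarrow> (nat \<times> nat) list \<Rightarrow> 'u monomial" where
  "u_monomial m w = (\<Sum>(i, j)\<leftarrow>w. Poly_Mapping.single (m i j) 1)"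

definition nested_configuration ::
    "nat \<Rightarrow> (nat \<Rightarrow> nat) \<Rightarrow> (nat \<Rightarrow> nat \<Rightarrow> 'u) \<Rightarrow> nat monomial set \<Rightarrow> 'u monomial set" where
  "nested_configuration d lam m A =
     {u_monomial m w |w. set w \<subseteq> letters d lam \<and> t_monomial w \<in> A}"

text \<open>
  The variables of \<open>K[x]\<close> are indexed by the elements of the nested configuration themselves, so
  the defining map of its toric ideal sends the variable with index \<open>M\<close> to the monomial \<open>M\<close>.
  If \<open>x_label d lam n a k w\<close> holds, then \<open>x_monomial m w\<close> is the variable with upper index \<open>k\<close> and
  letters \<open>w\<close>; the upper index need not be recorded, because the letters determine it.
\<close>

definition x_label ::
    "nat \<Rightarrow> (nat \<Rightarrow> nat) \<Rightarrow> nat \<Rightarrow> (nat \<Rightarrow> nat monomial) \<Rightarrow> nat \<Rightarrow> (nat \<times> nat) list \<Rightarrow> bool" where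
  "x_label d lam n a k w \<longleftrightarrow> k \<in> {1..n} \<and> set w \<subseteq> letters d lam \<and> t_monomial w = a k"

definition x_monomial :: "(nat \<Rightarrow> nat \<Rightarrow> 'u) \<Rightarrow> (nat \<times> nat) list \<Rightarrow> 'u monomial monomial" where
  "x_monomial m w = Poly_Mapping.single (u_monomial m w) 1"

definition y_monomial :: "nat list \<Rightarrow> nat monomial" where
  "y_monomial ks = (\<Sum>k\<leftarrow>ks. Poly_Mapping.single k 1)"

text \<open>
  The three families of binomials, as pairs of the underlined and the other monomial. The first
  family also records the underlined monomial in the variables \<open>y\<close>. As an element of \<open>G0\<close> may carry
  its initial monomial with either sign, it is matched up to sign.
\<close>

definition family1 ::
    "nat \<Rightarrow> (nat \<Rightarrow> nat) \<Rightarrow> nat \<Rightarrow> (nat \<Rightarrow> nat monomial) \<Rightarrow> (nat \<Rightarrow> nat \<Rightarrow> 'u) \<Rightarrow>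
     (nat monomial \<Rightarrow> nat monomial \<Rightarrow> bool) \<Rightarrow> (nat, 'k::field) mpoly set \<Rightarrow>
     (nat monomial \<times> 'u monomial monomial \<times> 'u monomial monomial) set" where
  "family1 d lam n a m lt0 G0 =
     {(y_monomial ks, \<Sum>w\<leftarrow>ws. x_monomial m w, \<Sum>w\<leftarrow>ws'. x_monomial m w) |ks ks' ws ws'.
        length ks = length ks' \<and>
        (\<exists>g\<in>G0. (g = binomial_poly (y_monomial ks) (y_monomial ks') \<or>
                 g = binomial_poly (y_monomial ks') (y_monomial ks)) \<and>
                initial_monomial lt0 g = y_monomial ks) \<and>
        list_all2 (x_label d lam n a) ks ws \<and> list_all2 (x_label d lam n a) ks' ws' \<and>
        sort (concat ws) = sort (concat ws')}"

text \<open>List positions start at 0: the letters \<open>(i'\<^sub>1, j'\<^sub>1), (i'\<^sub>3, j'\<^sub>3), \<dots>\<close> are those at even positions.\<close>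

definition family2 ::
    "nat \<Rightarrow> (nat \<Rightarrow> nat) \<Rightarrow> nat \<Rightarrow> (nat \<Rightarrow> nat monomial) \<Rightarrow> (nat \<Rightarrow> nat \<Rightarrow> 'u) \<Rightarrow>
     ('u monomial monomial \<times> 'u monomial monomial) set" where
  "family2 d lam n a m =
     {(M, N) |M N. M \<noteq> N \<and>
        (\<exists>k w1 w2 v1 v2.
           x_label d lam n a k w1 \<and> x_label d lam n a k w2 \<and>
           x_label d lam n a k v1 \<and> x_label d lam n a k v2 \<and>
           v1 = nths (sort (w1 @ w2)) {q. even q} \<and> v2 = nths (sort (w1 @ w2)) {q. odd q} \<and>
           M = x_monomial m w1 + x_monomial m w2 \<and> N = x_monomial m v1 + x_monomial m v2)}"

definition family3 ::
    "nat \<Rightarrow> (nat \<Rightarrow> nat) \<Rightarrow> nat \<Rightarrow> (nat \<Rightarrow> nat monomial) \<Rightarrow> (nat \<Rightarrow> nat \<Rightarrow> 'u) \<Rightarrow>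
     ('u monomial monomial \<times> 'u monomial monomial) set" where
  "family3 d lam n a m =
     {(x_monomial m w + x_monomial m w',
       x_monomial m (w[l := w' ! l']) + x_monomial m (w'[l' := w ! l])) |k k' w w' l l'.
        k < k' \<and> x_label d lam n a k w \<and> x_label d lam n a k' w' \<and>
        l < length w \<and> l' < length w' \<and>
        fst (w ! l) = fst (w' ! l') \<and> snd (w ! l) > snd (w' ! l')}"

end

theory Submission
  imports Defs "HOL-Library.Multiset_Order"
begin

text \<open>
  A monomial order is built that first compares the images in \<open>K[y]\<close> by \<open><\<^sub>0\<close>, so that (1) decreases;
  ties are broken by \<open>- \<Sum> k j\<close> over all letters \<open>(i, j)\<close> in variables \<open>x\<^sup>(\<^sup>k\<^sup>)\<close>, which decreases under (3)
  and is unchanged by (2); then by a convex function of the numbers of letters in initial segments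
  of the alphabet, which decreases under (2) because sorting balances these numbers.

  It remains to show that every fibre of the toric map contains only one monomial that is not
  divisible by an underlined monomial. Two such monomials have the same image in \<open>K[y]\<close>, since
  otherwise the difference of these images would contradict the Groebner basis property of \<open>G\<^sub>0\<close>. By (3), for each
  \<open>i\<close> the letters \<open>(i, j)\<close> occur in increasing order of \<open>j\<close> along increasing \<open>k\<close>, which determines the
  letters used by the variables of each kind \<open>k\<close>. By (2), the variables of kind \<open>k\<close> are pairwise
  sorted, so their letter counts are pairwise balanced, and a pairwise balanced family is determined
  by its size and its union.
\<close>

section \<open>Monomials, toric ideals and Groebner bases\<close>

text \<open>An exponent vector is the count function of a unique multiset of variables. Multisets
  offer induction on the factors, and divisibility becomes the submultiset relation.\<close>

definition mon :: "'v multiset \<Rightarrow> 'v monomial" where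
  "mon A = (\<Sum>x\<in>#A. Poly_Mapping.single x 1)"

lemma mon_empty [simp]: "mon {#} = 0"
  and mon_add_mset: "mon (add_mset x A) = Poly_Mapping.single x 1 + mon A"
  and mon_union: "mon (A + B) = mon A + mon B"
  by (simp_all add: mon_def)

lemma lookup_mon [simp]: "Poly_Mapping.lookup (mon A) x = count A x"
  by (induction A) (auto simp: mon_add_mset lookup_add lookup_single when_def)

lemma mon_eq_iff [simp]: "mon A = mon B \<longleftrightarrow> A = B"
  by (metis lookup_mon multiset_eqI)

lemma keys_mon [simp]: "Poly_Mapping.keys (mon A) = set_mset A"
  by (auto simp: in_keys_iff)

lemma mon_surj: "\<exists>A. p = mon A"
proof
  let ?A = "\<Sum>x\<in>Poly_Mapping.keys p. replicate_mset (Poly_Mapping.lookup p x) x"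
  show "p = mon ?A"
    by (rule poly_mapping_eqI) (simp add: count_sum in_keys_iff)
qed

lemma mon_sum_list: "(\<Sum>x\<leftarrow>xs. Poly_Mapping.single (f x) 1) = mon (mset (map f xs))"
  by (induction xs) (simp_all add: mon_add_mset)

lemma mon_sum_mset: "mon (\<Sum>\<^sub># (image_mset f U)) = (\<Sum>D\<in>#U. mon (f D))"
  by (induction U) (simp_all add: mon_union)

lemma mdeg_mon [simp]: "mdeg (mon A) = size A"
  by (simp add: mdeg_def size_multiset_overloaded_eq)

lemma mon_in_monomials [simp]: "mon A \<in> monomials X \<longleftrightarrow> set_mset A \<subseteq> X"
  by (simp add: monomials_def)

lemma squarefree_mon [simp]: "squarefree_monomial (mon A) \<longleftrightarrow> (\<forall>x. count A x \<le> 1)"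
  by (simp add: squarefree_monomial_def)

lemma mon_eq_plusD: "mon A = mon B + q \<Longrightarrow> B \<subseteq># A"
  by (metis mon_surj mon_union mon_eq_iff mset_subset_eq_add_left)

lemma monomials_add: "u \<in> monomials X \<Longrightarrow> v \<in> monomials X \<Longrightarrow> u + v \<in> monomials X"
  using keys_add[of u v] by (auto simp: monomials_def)

lemma finite_monomials_mdeg_le:
  assumes "finite X"
  shows "finite {u \<in> monomials X. mdeg u \<le> b}"
proof -
  have "finite (\<Union>k\<in>{..b}. mon ` multisets_of_size X k)"
    using assms by blast
  moreover have "{u \<in> monomials X. mdeg u \<le> b} \<subseteq> (\<Union>k\<in>{..b}. mon ` multisets_of_size X k)"
  proof
    fix u assume u: "u \<in> {u \<in> monomials X. mdeg u \<le> b}"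
    obtain A where "u = mon A" using mon_surj by blast
    with u show "u \<in> (\<Union>k\<in>{..b}. mon ` multisets_of_size X k)"
      by (auto simp: multisets_of_size_def)
  qed
  ultimately show ?thesis by (rule finite_subset[rotated])
qed

section \<open>Toric maps on monomials and membership in toric ideals\<close>

definition toric_image :: "('v \<Rightarrow> 'w monomial) \<Rightarrow> 'v monomial \<Rightarrow> 'w monomial" where
  "toric_image \<phi> u = (\<Sum>v\<in>#inv mon u. \<phi> v)"

lemma toric_image_mon [simp]: "toric_image \<phi> (mon A) = (\<Sum>v\<in>#A. \<phi> v)"
  by (simp add: toric_image_def inv_f_f inj_on_def)

lemma toric_image_0 [simp]: "toric_image \<phi> 0 = 0"
  using toric_image_mon[of \<phi> "{#}"] by simp

lemma monom_poly_mult: "monom_poly u * monom_poly v = monom_poly (u + v)"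
  by (simp add: monom_poly_def mult_single)

lemma keys_monom_poly [simp]: "Poly_Mapping.keys (monom_poly u :: ('v, 'k::field) mpoly) = {u}"
  by (simp add: monom_poly_def)

lemma monom_poly_eq_iff [simp]:
  "(monom_poly u :: ('v, 'k::field) mpoly) = monom_poly v \<longleftrightarrow> u = v"
  by (metis keys_monom_poly singleton_insert_inj_eq)

lemma prod_mset_monom_poly: "(\<Prod>v\<in>#A. monom_poly (\<phi> v)) = monom_poly (\<Sum>v\<in>#A. \<phi> v)"
  by (induction A) (simp_all add: monom_poly_mult, simp add: monom_poly_def)

lemma poly_subst_monom_poly:
  fixes p :: "('v, 'k::field) mpoly" and \<phi> :: "'v \<Rightarrow> 'w monomial"
  shows "poly_subst (\<lambda>v. monom_poly (\<phi> v)) p =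
     (\<Sum>u\<in>Poly_Mapping.keys p. Poly_Mapping.single (toric_image \<phi> u) (Poly_Mapping.lookup p u))"
proof -
  have "(\<Prod>v\<in>Poly_Mapping.keys u. monom_poly (\<phi> v) ^ Poly_Mapping.lookup u v) =
      (monom_poly (toric_image \<phi> u) :: ('w, 'k) mpoly)" for u
  proof -
    obtain A where "u = mon A" using mon_surj by blast
    then show ?thesis
      by (simp add: prod_mset_monom_poly flip: image_prod_mset_multiplicity)
  qed
  then show ?thesis
    unfolding poly_subst_def by (simp add: monom_poly_def mult_single)
qed

lemma lookup_poly_subst_monom_poly:
  "Poly_Mapping.lookup (poly_subst (\<lambda>v. monom_poly (\<phi> v)) p) z =
     (\<Sum>u | u \<in> Poly_Mapping.keys p \<and> toric_image \<phi> u = z. Poly_Mapping.lookup p u)"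
  unfolding poly_subst_monom_poly lookup_sum lookup_single when_def
  by (subst sum.inter_filter[symmetric]) (auto intro!: sum.cong)

text \<open>Coefficients of the image are sums of coefficients over fibres. If \<open>u\<close> were
  alone in its fibre, its nonzero coefficient would survive the substitution.\<close>

lemma toric_ideal_fiber:
  assumes "p \<in> toric_ideal X \<phi>" "u \<in> Poly_Mapping.keys p"
  shows "\<exists>v\<in>Poly_Mapping.keys p. v \<noteq> u \<and> toric_image \<phi> v = toric_image \<phi> u"
proof (rule ccontr)
  assume "\<not> ?thesis"
  with assms(2) have "{v. v \<in> Poly_Mapping.keys p \<and> toric_image \<phi> v = toric_image \<phi> u} = {u}"
    by auto
  then have "Poly_Mapping.lookup (poly_subst (\<lambda>v. monom_poly (\<phi> v)) p) (toric_image \<phi> u) =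
      Poly_Mapping.lookup p u"
    by (simp only: lookup_poly_subst_monom_poly sum.insert_remove) simp
  with assms show False
    by (simp add: toric_ideal_def in_keys_iff)
qed

lemma keys_binomial_poly:
  assumes "u \<noteq> v"
  shows "Poly_Mapping.keys (binomial_poly u v :: ('v, 'k::field) mpoly) = {u, v}"
  using assms
  by (auto simp: in_keys_iff binomial_poly_def monom_poly_def lookup_minus lookup_single when_def
      split: if_splits)

lemma binomial_poly_eq_0 [simp]: "binomial_poly u v = (0 :: ('v, 'k::field) mpoly) \<longleftrightarrow> u = v"
  by (simp add: binomial_poly_def)

lemma binomial_in_toric_ideal_iff:
  assumes "u \<noteq> v"
  shows "(binomial_poly u v :: ('v, 'k::field) mpoly) \<in> toric_ideal X \<phi> \<longleftrightarrow>
    u \<in> monomials X \<and> v \<in> monomials X \<and> toric_image \<phi> u = toric_image \<phi> v"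
proof
  assume *: "(binomial_poly u v :: ('v, 'k) mpoly) \<in> toric_ideal X \<phi>"
  then have "{u, v} \<subseteq> monomials X"
    by (simp add: toric_ideal_def poly_ring_def keys_binomial_poly[OF assms])
  then show "u \<in> monomials X \<and> v \<in> monomials X \<and> toric_image \<phi> u = toric_image \<phi> v"
    using toric_ideal_fiber[OF *, of u] assms by (auto simp: keys_binomial_poly[OF assms])
next
  assume *: "u \<in> monomials X \<and> v \<in> monomials X \<and> toric_image \<phi> u = toric_image \<phi> v"
  have "poly_subst (\<lambda>x. monom_poly (\<phi> x)) (binomial_poly u v :: ('v, 'k) mpoly) = 0"
    unfolding poly_subst_monom_poly keys_binomial_poly[OF assms]
    using * assms
    by (simp add: binomial_poly_def monom_poly_def lookup_minus lookup_single single_add[symmetric])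
  then show "(binomial_poly u v :: ('v, 'k) mpoly) \<in> toric_ideal X \<phi>"
    using * by (simp add: toric_ideal_def poly_ring_def keys_binomial_poly[OF assms])
qed

section \<open>Initial monomials\<close>

text \<open>The support is finite and nonempty and \<open>lt\<close> is a strict total order on it,
  so the description in \<open>initial_monomial\<close> has exactly one solution.\<close>

lemma initial_monomial_greatest:
  assumes ord: "monomial_order X lt" and p: "p \<in> poly_ring X" "p \<noteq> 0"
  shows "initial_monomial lt p \<in> Poly_Mapping.keys p \<and>
    (\<forall>v\<in>Poly_Mapping.keys p. v \<noteq> initial_monomial lt p \<longrightarrow> lt v (initial_monomial lt p))"
proof -
  let ?K = "Poly_Mapping.keys p"
  have K: "?K \<subseteq> monomials X" using p by (simp add: poly_ring_def)
  have o: "irreflp_on ?K lt" "transp_on ?K lt" "totalp_on ?K lt"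
    using ord K unfolding monomial_order_def
    by (auto intro: irreflp_on_subset transp_on_subset totalp_on_subset)
  then have "\<exists>u\<in>?K. \<forall>v\<in>?K. v \<noteq> u \<longrightarrow> lt v u"
    using p by (intro Finite_Set.bex_greatest_element)
      (auto simp: asymp_on_iff_irreflp_on_if_transp_on)
  then obtain u where u: "u \<in> ?K" "\<forall>v\<in>?K. v \<noteq> u \<longrightarrow> lt v u" by blast
  have "u' = u" if "u' \<in> ?K \<and> (\<forall>v\<in>?K. v \<noteq> u' \<longrightarrow> lt v u')" for u'
    using that u o(1,2) unfolding irreflp_on_def transp_on_def by metis
  with u have "\<exists>!u. u \<in> ?K \<and> (\<forall>v\<in>?K. v \<noteq> u \<longrightarrow> lt v u)" by blast
  then show ?thesis
    unfolding initial_monomial_def by (rule theI')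
qed

lemma binomial_in_poly_ring:
  "u \<in> monomials X \<Longrightarrow> v \<in> monomials X \<Longrightarrow> binomial_poly u v \<in> poly_ring X"
  by (cases "u = v") (auto simp: poly_ring_def keys_binomial_poly, simp add: binomial_poly_def)

lemma initial_monomial_binomial:
  assumes "monomial_order X lt" "u \<in> monomials X" "v \<in> monomials X" "lt v u"
  shows "initial_monomial lt (binomial_poly u v :: ('v, 'k::field) mpoly) = u"
proof -
  have *: "u \<noteq> v" using assms by (auto simp: monomial_order_def irreflp_on_def)
  have "\<not> lt u v"
    using assms by (auto simp: monomial_order_def irreflp_on_def transp_on_def)
  with * show ?thesis
    using initial_monomial_greatest[OF assms(1)
        binomial_in_poly_ring[OF assms(2,3), where ?'b='k]] by (auto simp: keys_binomial_poly)
qed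

section \<open>Monomial ideals and the divisibility criterion for Groebner bases\<close>

lemma poly_ring_mult:
  assumes "p \<in> poly_ring X" "q \<in> poly_ring X"
  shows "p * q \<in> poly_ring X"
  using assms keys_mult[of p q] monomials_add unfolding poly_ring_def by fastforce

lemma poly_ring_sum: "(\<And>i. i \<in> I \<Longrightarrow> f i \<in> poly_ring X) \<Longrightarrow> sum f I \<in> poly_ring X"
  using keys_sum[of f I] unfolding poly_ring_def by fastforce

lemma ideal_generated_subset:
  assumes "\<And>s. s \<in> S' \<Longrightarrow> \<exists>t\<in>S. \<exists>q\<in>poly_ring X. s = q * t"
  shows "ideal_generated X S' \<subseteq> ideal_generated X S"
proof
  fix p assume "p \<in> ideal_generated X S'"
  then obtain T c where p: "p = (\<Sum>s\<in>T. c s * s)" "finite T" "T \<subseteq> S'" "\<forall>s\<in>T. c s \<in> poly_ring X"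
    unfolding ideal_generated_def by blast
  obtain t q where tq: "\<And>s. s \<in> S' \<Longrightarrow> t s \<in> S \<and> q s \<in> poly_ring X \<and> s = q s * t s"
    using assms by metis
  \<comment> \<open>Several \<open>s\<close> may share one \<open>t s\<close>, while a member of
    \<open>ideal_generated\<close> has a single coefficient per generator; so the coefficients are
    collected.\<close>
  define c' where "c' = (\<lambda>y. \<Sum>s | s \<in> T \<and> t s = y. c s * q s)"
  have "p = (\<Sum>s\<in>T. c s * q s * t s)"
    unfolding p(1) using p(3) tq by (intro sum.cong) (auto simp: mult.assoc)
  also have "\<dots> = (\<Sum>y\<in>t ` T. \<Sum>s | s \<in> T \<and> t s = y. c s * q s * t s)"
    by (rule sum.image_gen[OF p(2)])
  also have "\<dots> = (\<Sum>y\<in>t ` T. c' y * y)"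
    unfolding c'_def by (intro sum.cong refl) (simp add: sum_distrib_right)
  finally have "p = (\<Sum>y\<in>t ` T. c' y * y)" .
  moreover have "\<forall>y\<in>t ` T. c' y \<in> poly_ring X"
    unfolding c'_def using p tq by (intro ballI poly_ring_sum poly_ring_mult) auto
  moreover have "t ` T \<subseteq> S" using p(3) tq by auto
  ultimately show "p \<in> ideal_generated X S"
    unfolding ideal_generated_def using p(2) by blast
qed

text \<open>The monomial \<open>u\<close> must occur in some summand \<open>c s * s\<close>; as
  \<open>s\<close> is itself a monomial, every exponent occurring there is a multiple of it.\<close>

lemma monom_poly_in_ideal_generatedD:
  assumes "(monom_poly u :: ('v, 'k::field) mpoly) \<in> ideal_generated X (monom_poly ` H)"
  shows "\<exists>h\<in>H. \<exists>q. u = q + h"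
proof -
  obtain T c where p: "(monom_poly u :: ('v, 'k) mpoly) = (\<Sum>s\<in>T. c s * s)" "T \<subseteq> monom_poly ` H"
    using assms unfolding ideal_generated_def by blast
  have "u \<in> Poly_Mapping.keys (monom_poly u :: ('v, 'k) mpoly)" by simp
  then obtain s where s: "s \<in> T" "u \<in> Poly_Mapping.keys (c s * s)"
    unfolding p(1) using keys_sum by fastforce
  with p(2) obtain h where h: "h \<in> H" "s = monom_poly h" by blast
  with s(2) keys_mult[of "c s" s] obtain q where "u = q + h" by auto
  with h(1) show ?thesis by blast
qed

lemma monom_poly_in_ideal_generatedI:
  assumes "u \<in> S"
  shows "(monom_poly u :: ('v, 'k::field) mpoly) \<in> ideal_generated X (monom_poly ` S)"
  unfolding ideal_generated_def
  using assms
  by (intro CollectI exI[of _ "{monom_poly u}"] exI[of _ "\<lambda>_. 1"])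
    (auto simp: poly_ring_def monomials_def)

lemma groebner_basis_divides:
  fixes I G :: "('v, 'k::field) mpoly set"
  assumes gb: "groebner_basis X lt I G" and f: "f \<in> I" "f \<noteq> 0"
  shows "\<exists>g\<in>G. \<exists>q. initial_monomial lt f = q + initial_monomial lt g"
proof -
  have "(monom_poly (initial_monomial lt f) :: ('v, 'k) mpoly) \<in>
      ideal_generated X (monom_poly ` initial_monomial lt ` G)"
    using gb f monom_poly_in_ideal_generatedI[of "initial_monomial lt f" "initial_monomial lt ` (I - {0})" X,
        where ?'k='k]
    by (simp add: groebner_basis_def image_image)
  then show ?thesis
    using monom_poly_in_ideal_generatedD by blast
qed

text \<open>One inclusion of initial ideals comes from \<open>G\<close> consisting of nonzero
  elements of \<open>I\<close>. For the other, \<open>q\<close> is taken in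
  \<open>monomials X\<close> so that \<open>monom_poly q\<close> is an admissible
  coefficient.\<close>

lemma groebner_basisI:
  assumes "finite G" "G \<subseteq> I" "0 \<notin> G"
    and div: "\<And>f. f \<in> I \<Longrightarrow> f \<noteq> 0 \<Longrightarrow>
      \<exists>g\<in>G. \<exists>q\<in>monomials X. initial_monomial lt f = q + initial_monomial lt g"
  shows "groebner_basis X lt I G"
  unfolding groebner_basis_def
proof (intro conjI equalityI)
  show "ideal_generated X ((\<lambda>g. monom_poly (initial_monomial lt g)) ` G) \<subseteq>
    ideal_generated X ((\<lambda>f. monom_poly (initial_monomial lt f)) ` (I - {0}))"
    unfolding ideal_generated_def using assms(2,3) by blast
  show "ideal_generated X ((\<lambda>f. monom_poly (initial_monomial lt f)) ` (I - {0})) \<subseteq>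
    ideal_generated X ((\<lambda>g. monom_poly (initial_monomial lt g)) ` G)"
  proof (rule ideal_generated_subset)
    fix s assume "s \<in> (\<lambda>f. monom_poly (initial_monomial lt f)) ` (I - {0})"
    then obtain f where f: "f \<in> I" "f \<noteq> 0" "s = monom_poly (initial_monomial lt f)" by blast
    from div[OF f(1,2)] obtain g q where gq: "g \<in> G" "q \<in> monomials X"
      "initial_monomial lt f = q + initial_monomial lt g" by blast
    then have "s = monom_poly q * monom_poly (initial_monomial lt g)"
      by (simp add: f monom_poly_mult)
    moreover have "monom_poly q \<in> poly_ring X" using gq by (simp add: poly_ring_def)
    ultimately show "\<exists>t\<in>(\<lambda>g. monom_poly (initial_monomial lt g)) ` G. \<exists>q\<in>poly_ring X. s = q * t"
      using gq by blast
  qed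
qed (use assms in auto)

section \<open>Balanced and ordered families of multisets\<close>

lemma sum_mset_map_mset: "\<Sum>\<^sub># (mset (map mset ws)) = mset (concat ws)"
  by (induction ws) simp_all

lemma count_le_count_image_mset: "count A x \<le> count (image_mset f A) (f x)"
  by (induction A) auto

section \<open>Prefix counts and balanced families\<close>

definition cnt :: "'l::linorder \<Rightarrow> 'l multiset \<Rightarrow> nat" where
  "cnt c D = size (filter_mset (\<lambda>x. x \<le> c) D)"

text \<open>Not symmetric: \<open>D\<close> leads by 0 or 1 in each initial segment, as the even
  positions of a sorted list do over the odd ones.\<close>

definition balanced :: "'l::linorder set \<Rightarrow> 'l multiset \<Rightarrow> 'l multiset \<Rightarrow> bool" where
  "balanced C D E \<longleftrightarrow> (\<forall>c\<in>C. cnt c E \<le> cnt c D \<and> cnt c D \<le> cnt c E + 1)"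

lemma cnt_union [simp]: "cnt c (D + E) = cnt c D + cnt c E"
  by (simp add: cnt_def)

lemma cnt_sum_mset: "cnt c (\<Sum>\<^sub># U) = (\<Sum>D\<in>#U. cnt c D)"
  by (induction U) (simp_all add: cnt_def)

text \<open>At the least letter whose multiplicities differ, the prefix counts differ as
  well.\<close>

lemma cnt_eqI:
  assumes "set_mset D \<subseteq> C" "set_mset E \<subseteq> C" and eq: "\<And>c. c \<in> C \<Longrightarrow> cnt c D = cnt c E"
  shows "D = E"
proof (rule ccontr)
  assume "D \<noteq> E"
  define S where "S = {x. count D x \<noteq> count E x}"
  have S: "S \<subseteq> set_mset D \<union> set_mset E"
    by (auto simp: S_def) (metis count_eq_zero_iff)
  then have fin: "finite S" by (rule finite_subset) simp
  have ne: "S \<noteq> {}" using \<open>D \<noteq> E\<close> by (auto simp: S_def multiset_eq_iff)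
  let ?c = "Min S"
  have c: "?c \<in> S" using fin ne by simp
  have below: "count D x = count E x" if "x < ?c" for x
  proof -
    have "x \<notin> S" using that Min_le[OF fin, of x] by auto
    then show ?thesis by (simp add: S_def)
  qed
  have split: "cnt ?c M = size (filter_mset (\<lambda>x. x < ?c) M) + count M ?c" for M
  proof -
    have "filter_mset (\<lambda>x. x \<le> ?c) M = filter_mset (\<lambda>x. x < ?c) M + replicate_mset (count M ?c) ?c"
      by (rule multiset_eqI) auto
    then show ?thesis by (simp add: cnt_def)
  qed
  have "filter_mset (\<lambda>x. x < ?c) D = filter_mset (\<lambda>x. x < ?c) E"
    by (rule multiset_eqI) (simp add: below)
  moreover have "?c \<in> C" using c S assms(1,2) by blast
  ultimately have "count D ?c = count E ?c" using eq[of ?c] by (simp add: split)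
  with c show False by (simp add: S_def)
qed

text \<open>As \<open>balanced\<close> is not transitive in general, \<open>D\<close> is chosen with
  the largest total of counts. If some \<open>E\<close> is balanced over \<open>D\<close>,
  maximality forces all their counts to agree, and then \<open>D\<close> is balanced over
  \<open>E\<close> too.\<close>

lemma balanced_max:
  assumes "finite C" "U \<noteq> {#}"
    and total: "\<And>D E. D \<in># U \<Longrightarrow> E \<in># U \<Longrightarrow> balanced C D E \<or> balanced C E D"
  shows "\<exists>D\<in>#U. \<forall>E\<in>#U. balanced C D E"
proof -
  define s where "s D = (\<Sum>c\<in>C. cnt c D)" for D
  have "Max (s ` set_mset U) \<in> s ` set_mset U" using assms(2) by (intro Max_in) auto
  then obtain D where D: "D \<in># U" "s D = Max (s ` set_mset U)" by auto
  have "balanced C D E" if E: "E \<in># U" for E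
  proof (cases "balanced C D E")
    case False
    with total[OF D(1) E] have ED: "balanced C E D" by simp
    then have le: "cnt c D \<le> cnt c E" if "c \<in> C" for c using that by (simp add: balanced_def)
    have "s E \<le> s D" using D(2) E by simp
    moreover have "s D \<le> s E" unfolding s_def using le by (rule sum_mono)
    ultimately have "cnt c D = cnt c E" if "c \<in> C" for c
      using that le assms(1) unfolding s_def
      by (intro sum_mono_inv[of "\<lambda>c. cnt c D" C "\<lambda>c. cnt c E"]) auto
    then show ?thesis by (simp add: balanced_def)
  qed
  with D(1) show ?thesis by blast
qed

text \<open>Each member falls short of \<open>D\<close> by 0 or 1, and \<open>D\<close> itself by 0.
  The total shortfall is thus below \<open>size U\<close>, which makes the second bound
  strict.\<close>

lemma cnt_balanced_bounds:
  assumes "D \<in># U" "\<forall>E\<in>#U. balanced C D E" "c \<in> C"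
  shows "cnt c (\<Sum>\<^sub># U) \<le> size U * cnt c D" "size U * cnt c D < cnt c (\<Sum>\<^sub># U) + size U"
proof -
  obtain U' where U: "U = add_mset D U'" using assms(1) by (metis mset_add)
  have "\<forall>E\<in>#U'. balanced C D E" using assms(2) U by simp
  then have "(\<Sum>E\<in>#U'. cnt c E) \<le> size U' * cnt c D \<and>
      size U' * cnt c D \<le> (\<Sum>E\<in>#U'. cnt c E) + size U'"
    using assms(3) by (induction U') (auto simp: balanced_def)
  then show "cnt c (\<Sum>\<^sub># U) \<le> size U * cnt c D" "size U * cnt c D < cnt c (\<Sum>\<^sub># U) + size U"
    unfolding cnt_sum_mset by (auto simp: U)
qed

text \<open>Size and union fix the counts of a member that is balanced over all others. This member
  is therefore common to both families and can be removed from each, by induction on the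
  size.\<close>

lemma balanced_unique:
  assumes "finite C" "size U = size V" "\<Sum>\<^sub># U = \<Sum>\<^sub># V"
    and "\<And>D. D \<in># U \<Longrightarrow> set_mset D \<subseteq> C" "\<And>D. D \<in># V \<Longrightarrow> set_mset D \<subseteq> C"
    and "\<And>D E. D \<in># U \<Longrightarrow> E \<in># U \<Longrightarrow> balanced C D E \<or> balanced C E D"
    and "\<And>D E. D \<in># V \<Longrightarrow> E \<in># V \<Longrightarrow> balanced C D E \<or> balanced C E D"
  shows "U = V"
  using assms(2-)
proof (induction "size U" arbitrary: U V)
  case 0
  then show ?case by simp
next
  case (Suc n)
  then have ne: "U \<noteq> {#}" "V \<noteq> {#}" by auto
  obtain D where D: "D \<in># U" "\<forall>E\<in>#U. balanced C D E"
    using balanced_max[OF assms(1) ne(1)] Suc.prems(5) by blast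
  obtain D' where D': "D' \<in># V" "\<forall>E\<in>#V. balanced C D' E"
    using balanced_max[OF assms(1) ne(2)] Suc.prems(6) by blast
  \<comment> \<open>Both counts are the average \<open>cnt c (\<Sum>\<^sub># U) / size U\<close> rounded up.\<close>
  have "cnt c D = cnt c D'" if c: "c \<in> C" for c
  proof -
    note b = cnt_balanced_bounds[OF D c] cnt_balanced_bounds[OF D' c]
    have "size U * cnt c D < size U * Suc (cnt c D')" "size U * cnt c D' < size U * Suc (cnt c D)"
      using b Suc.prems(1,2) by simp_all
    then show ?thesis unfolding mult_less_cancel1 by simp
  qed
  then have DD: "D = D'" using cnt_eqI[of D C D'] Suc.prems(3)[OF D(1)] Suc.prems(4)[OF D'(1)] by blast
  obtain U' V' where UV: "U = add_mset D U'" "V = add_mset D V'"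
    using D D' DD by (metis mset_add)
  have "U' = V'"
    using Suc by (intro Suc.hyps(1)) (auto simp: UV)
  then show ?case by (simp add: UV)
qed

section \<open>Ordered blocks as consecutive stretches of a sorted list\<close>

lemma sorted_list_of_multiset_union:
  assumes "\<And>x y. x \<in># A \<Longrightarrow> y \<in># B \<Longrightarrow> x \<le> y"
  shows "sorted_list_of_multiset (A + B) = sorted_list_of_multiset A @ sorted_list_of_multiset B"
proof -
  let ?xs = "sorted_list_of_multiset A @ sorted_list_of_multiset B"
  have "sorted ?xs" using assms by (simp add: sorted_append)
  then show ?thesis
    by (metis mset_append mset_sorted_list_of_multiset sorted_list_of_multiset_mset sorted_sort_id)
qed

text \<open>The upper part is the final stretch of the sorted list of the union, and its length is
  prescribed.\<close>

lemma ordered_union_unique: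
  fixes A B S T :: "'l::linorder multiset"
  assumes "A + S = B + T" "size S = size T"
    and "\<And>x y. x \<in># A \<Longrightarrow> y \<in># S \<Longrightarrow> x \<le> y" "\<And>x y. x \<in># B \<Longrightarrow> y \<in># T \<Longrightarrow> x \<le> y"
  shows "S = T"
proof -
  have "sorted_list_of_multiset A @ sorted_list_of_multiset S =
      sorted_list_of_multiset B @ sorted_list_of_multiset T"
    using assms by (simp flip: sorted_list_of_multiset_union)
  moreover have "length (sorted_list_of_multiset S) = length (sorted_list_of_multiset T)"
    using assms(2) by (metis mset_sorted_list_of_multiset size_mset)
  ultimately show ?thesis
    by (metis append_eq_append_conv mset_sorted_list_of_multiset)
qed

text \<open>The blocks cut the sorted list of their union at prescribed places; the induction splits
  off the last block.\<close>

lemma ordered_blocks_unique: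
  fixes S T :: "nat \<Rightarrow> 'l::linorder multiset"
  assumes "(\<Sum>k\<in>{1..n}. S k) = (\<Sum>k\<in>{1..n}. T k)" "\<And>k. k \<in> {1..n} \<Longrightarrow> size (S k) = size (T k)"
    and "\<And>k k' x y. k \<in> {1..n} \<Longrightarrow> k' \<in> {1..n} \<Longrightarrow> k < k' \<Longrightarrow> x \<in># S k \<Longrightarrow> y \<in># S k' \<Longrightarrow> x \<le> y"
    and "\<And>k k' x y. k \<in> {1..n} \<Longrightarrow> k' \<in> {1..n} \<Longrightarrow> k < k' \<Longrightarrow> x \<in># T k \<Longrightarrow> y \<in># T k' \<Longrightarrow> x \<le> y"
    and "k \<in> {1..n}"
  shows "S k = T k"
  using assms
proof (induction n arbitrary: k)
  case 0
  then show ?case by simp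
next
  case (Suc n)
  have mem: "x \<in># (\<Sum>k\<in>{1..n}. R k) \<Longrightarrow> \<exists>k\<in>{1..n}. x \<in># R k" for x and R :: "nat \<Rightarrow> 'l multiset"
    by (auto simp: set_mset_sum)
  have last: "S (Suc n) = T (Suc n)"
  proof (rule ordered_union_unique)
    show "(\<Sum>k\<in>{1..n}. S k) + S (Suc n) = (\<Sum>k\<in>{1..n}. T k) + T (Suc n)"
      using Suc.prems(1) by simp
    show "x \<le> y" if "x \<in># (\<Sum>k\<in>{1..n}. S k)" "y \<in># S (Suc n)" for x y
      using mem[OF that(1)] that(2) Suc.prems(3)[of _ "Suc n"] by fastforce
    show "x \<le> y" if "x \<in># (\<Sum>k\<in>{1..n}. T k)" "y \<in># T (Suc n)" for x y
      using mem[OF that(1)] that(2) Suc.prems(4)[of _ "Suc n"] by fastforce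
  qed (use Suc.prems in simp)
  show ?case
  proof (cases "k = Suc n")
    case False
    show ?thesis
    proof (rule Suc.IH)
      show "(\<Sum>k\<in>{1..n}. S k) = (\<Sum>k\<in>{1..n}. T k)" using Suc.prems(1) last by simp
      show "x \<le> y" if "k \<in> {1..n}" "k' \<in> {1..n}" "k < k'" "x \<in># S k" "y \<in># S k'" for k k' x y
        using Suc.prems(3)[of k k'] that by simp
      show "x \<le> y" if "k \<in> {1..n}" "k' \<in> {1..n}" "k < k'" "x \<in># T k" "y \<in># T k'" for k k' x y
        using Suc.prems(4)[of k k'] that by simp
    qed (use Suc.prems False in auto)
  qed (use last in simp)
qed

section \<open>Sorting and splitting by parity of positions\<close>

text \<open>Removing the head exchanges the parities, so facts about the two halves are proved by a
  joint induction.\<close>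

lemma nths_even_Cons: "nths (x # xs) {q. even q} = x # nths xs {q. odd q}"
  and nths_odd_Cons: "nths (x # xs) {q. odd q} = nths xs {q. even q}"
  by (simp_all add: nths_Cons)

lemma mset_nths_even_odd: "mset (nths xs {q. even q}) + mset (nths xs {q. odd q}) = mset xs"
  by (induction xs) (simp_all add: nths_even_Cons nths_odd_Cons add.commute)

text \<open>\<open>P\<close> holds exactly on an initial segment of the sorted list, and such a
  segment has as many even as odd positions or one even position more.\<close>

lemma sorted_nths_even_odd:
  assumes "sorted xs" "\<And>x y. x \<le> y \<Longrightarrow> P y \<Longrightarrow> P x"
  shows "length (filter P (nths xs {q. odd q})) \<le> length (filter P (nths xs {q. even q})) \<and>
    length (filter P (nths xs {q. even q})) \<le> Suc (length (filter P (nths xs {q. odd q})))"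
  using assms(1)
proof (induction xs)
  case (Cons x xs)
  show ?case
  proof (cases "P x")
    case True
    with Cons show ?thesis by (auto simp: nths_even_Cons nths_odd_Cons)
  next
    case False
    with Cons.prems assms(2) have "\<not> P y" if "y \<in> set xs" for y using that by auto
    moreover have "set (nths xs I) \<subseteq> set xs" for I by (rule set_nths_subset)
    ultimately have "filter P (nths xs I) = []" for I by (auto simp: filter_empty_conv)
    with False show ?thesis by (simp add: nths_even_Cons nths_odd_Cons)
  qed
qed simp

lemma balanced_sorted_nths:
  assumes "sorted xs"
  shows "balanced C (mset (nths xs {q. even q})) (mset (nths xs {q. odd q}))"
  using sorted_nths_even_odd[OF assms, of "\<lambda>x. x \<le> c" for c] order_trans
  unfolding balanced_def cnt_def
  by (auto simp flip: mset_filter)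

text \<open>This makes the second monomial of (2) consist of variables of the same kind as the
  first: two counts that differ by at most 1 and add up to an even number are equal.\<close>

lemma image_fst_sorted_nths:
  fixes xs :: "('a::linorder \<times> 'b::linorder) list"
  assumes "sorted xs" "image_mset fst (mset xs) = A + A"
  shows "image_mset fst (mset (nths xs {q. even q})) = A"
    and "image_mset fst (mset (nths xs {q. odd q})) = A"
proof -
  let ?E = "nths xs {q. even q}" and ?O = "nths xs {q. odd q}"
  have cnt: "cnt i (image_mset fst (mset ys)) = length (filter (\<lambda>x. fst x \<le> i) ys)"
    for i and ys :: "('a \<times> 'b) list"
    by (simp add: cnt_def filter_mset_image_mset flip: mset_filter)
  have sum: "image_mset fst (mset ?E) + image_mset fst (mset ?O) = A + A"
    using assms(2) by (simp flip: image_mset_union add: mset_nths_even_odd)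
  have "cnt i (image_mset fst (mset ?E)) = cnt i A \<and> cnt i (image_mset fst (mset ?O)) = cnt i A" for i
  proof -
    \<comment> \<open>The predicate \<open>fst x \<le> i\<close> is downward closed in the
      lexicographic order, so it cuts out an initial segment of \<open>xs\<close>.\<close>
    have "cnt i (image_mset fst (mset ?O)) \<le> cnt i (image_mset fst (mset ?E)) \<and>
        cnt i (image_mset fst (mset ?E)) \<le> Suc (cnt i (image_mset fst (mset ?O)))"
      unfolding cnt using assms(1)
      by (rule sorted_nths_even_odd) (auto simp: less_eq_prod_def)
    moreover have "cnt i (image_mset fst (mset ?E)) + cnt i (image_mset fst (mset ?O)) = cnt i A + cnt i A"
      by (simp only: sum flip: cnt_union)
    ultimately show ?thesis by linarith
  qed
  then show "image_mset fst (mset ?E) = A" "image_mset fst (mset ?O) = A"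
    by (auto intro: cnt_eqI[of _ UNIV])
qed

section \<open>A convex measure of imbalance\<close>

text \<open>
  Differences of counts are included, not only counts: swapping letters can move one prefix count up
  and another down by 1 without changing the sum of the squares of the counts.
\<close>

definition spread :: "'l::linorder set \<Rightarrow> 'l multiset \<Rightarrow> int" where
  "spread C D = (\<Sum>(c, c')\<in>C \<times> C. (int (cnt c D) - int (cnt c' D))\<^sup>2)"

text \<open>By the identity \<open>eq\<close>, for a fixed sum the sum of squares depends only on
  the absolute difference and increases with it.\<close>

lemma sum_squares_balanced:
  fixes a b a' b' :: int
  assumes "a + b = a' + b'" "\<bar>a' - b'\<bar> \<le> 1"
  shows "a'\<^sup>2 + b'\<^sup>2 \<le> a\<^sup>2 + b\<^sup>2" and "\<bar>a - b\<bar> \<ge> 2 \<Longrightarrow> a'\<^sup>2 + b'\<^sup>2 < a\<^sup>2 + b\<^sup>2"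
proof -
  have eq: "2 * (x\<^sup>2 + y\<^sup>2) = (x + y)\<^sup>2 + (x - y)\<^sup>2" for x y :: int
    by (simp add: power2_eq_square algebra_simps)
  have 1: "(a' - b')\<^sup>2 \<le> (a - b)\<^sup>2"
  proof (cases "a = b")
    case True
    \<comment> \<open>Here \<open>a' + b'\<close> is even, so a difference of absolute value at most
      1 must vanish.\<close>
    then have "a' = b'" using assms by presburger
    then show ?thesis by simp
  next
    case False
    then have "\<bar>a' - b'\<bar> \<le> \<bar>a - b\<bar>" using assms(2) by linarith
    then show ?thesis by (simp add: abs_le_square_iff)
  qed
  then show "a'\<^sup>2 + b'\<^sup>2 \<le> a\<^sup>2 + b\<^sup>2" using eq[of a b] eq[of a' b'] assms(1) by simp
  assume "\<bar>a - b\<bar> \<ge> 2"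
  then have "\<bar>a' - b'\<bar> < \<bar>a - b\<bar>" using assms(2) by linarith
  then have "(a' - b')\<^sup>2 < (a - b)\<^sup>2" by (metis abs_ge_zero power2_abs power_strict_mono zero_less_numeral)
  then show "a'\<^sup>2 + b'\<^sup>2 < a\<^sup>2 + b\<^sup>2" using eq[of a b] eq[of a' b'] assms(1) by simp
qed

text \<open>For each pair of letters the two values of \<open>f\<close> have the same sum before and
  after. Balance leaves a gap of at most 1 between the new values, so no term grows, and one old gap
  of at least 2 makes the total drop.\<close>

lemma spread_less:
  fixes D E D' E' :: "'l::linorder multiset"
  assumes C: "finite C" "z \<in> C" and z: "cnt z D = 0" "cnt z E = 0"
    and sum: "D' + E' = D + E" and bal: "balanced C D' E'"
    and unbal: "\<not> balanced C D E" "\<not> balanced C E D"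
  shows "spread C D' + spread C E' < spread C D + spread C E"
proof -
  have cnt: "int (cnt c D) + int (cnt c E) = int (cnt c D') + int (cnt c E')" for c
    using sum by (metis cnt_union of_nat_add)
  define f where "f M = (\<lambda>(c, c'). int (cnt c M) - int (cnt c' M))" for M :: "'l multiset"
  have sum_f: "f D p + f E p = f D' p + f E' p" for p
    using cnt[of "fst p"] cnt[of "snd p"] by (simp add: f_def case_prod_unfold)
  have bal_f: "\<bar>f D' p - f E' p\<bar> \<le> 1" if p: "p \<in> C \<times> C" for p
  proof -
    have "fst p \<in> C" "snd p \<in> C" using p by auto
    with bal have "cnt (fst p) E' \<le> cnt (fst p) D'" "cnt (fst p) D' \<le> cnt (fst p) E' + 1"
      "cnt (snd p) E' \<le> cnt (snd p) D'" "cnt (snd p) D' \<le> cnt (snd p) E' + 1"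
      unfolding balanced_def by blast+
    then show ?thesis by (simp add: f_def case_prod_unfold)
  qed
  obtain c1 where c1: "c1 \<in> C" "cnt c1 D < cnt c1 E \<or> cnt c1 E + 1 < cnt c1 D"
    using unbal(1) by (auto simp: balanced_def not_le)
  obtain c2 where c2: "c2 \<in> C" "cnt c2 E < cnt c2 D \<or> cnt c2 D + 1 < cnt c2 E"
    using unbal(2) by (auto simp: balanced_def not_le)
  \<comment> \<open>If the counts at \<open>c1\<close> or at \<open>c2\<close> differ by at least 2,
    pairing that letter with \<open>z\<close>, where all counts are 0, suffices. Otherwise
    \<open>D\<close> trails by 1 at \<open>c1\<close> and leads by 1 at \<open>c2\<close>, and the
    gap at \<open>(c1, c2)\<close> is 2.\<close>
  have "\<exists>p\<in>C \<times> C. \<bar>f D p - f E p\<bar> \<ge> 2"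
  proof -
    have "\<bar>f D (c1, z) - f E (c1, z)\<bar> \<ge> 2 \<or> \<bar>f D (c2, z) - f E (c2, z)\<bar> \<ge> 2 \<or>
        \<bar>f D (c1, c2) - f E (c1, c2)\<bar> \<ge> 2"
      using c1(2) c2(2) z by (simp add: f_def) linarith
    then show ?thesis using c1(1) c2(1) C(2) by blast
  qed
  then obtain p where "p \<in> C \<times> C" "(f D' p)\<^sup>2 + (f E' p)\<^sup>2 < (f D p)\<^sup>2 + (f E p)\<^sup>2"
    using sum_squares_balanced(2)[OF sum_f bal_f] by blast
  then have "(\<Sum>p\<in>C \<times> C. (f D' p)\<^sup>2 + (f E' p)\<^sup>2) < (\<Sum>p\<in>C \<times> C. (f D p)\<^sup>2 + (f E p)\<^sup>2)"
    using C(1) sum_squares_balanced(1)[OF sum_f bal_f] by (intro sum_strict_mono_ex1 bexI[of _ p]) simp_all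
  then show ?thesis
    by (simp add: spread_def f_def case_prod_unfold flip: sum.distrib)
qed

section \<open>Monomials of the nested configuration as multisets of labels\<close>

locale nested_config =
  fixes d n r :: nat
    and a :: "nat \<Rightarrow> nat monomial"
    and lam :: "nat \<Rightarrow> nat"
    and m :: "nat \<Rightarrow> nat \<Rightarrow> 'u"
  assumes configuration: "configuration d n a"
    and degree: "\<forall>k\<in>{1..n}. mdeg (a k) = r"
    and inj_m: "\<forall>i\<in>{1..d}. inj_on (m i) {1..lam i}"
    and disjoint_m: "disjoint_family_on (\<lambda>i. m i ` {1..lam i}) {1..d}"
begin

abbreviation "L \<equiv> letters d lam"
abbreviation "X \<equiv> nested_configuration d lam m (a ` {1..n})"

text \<open>
  A variable of \<open>K[x]\<close> is represented by the multiset of its letters, its label, and a monomial by the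
  multiset of the labels of its factors. The upper index is the \<open>kind\<close> of the label.
\<close>

definition emb :: "nat \<times> nat \<Rightarrow> 'u" where "emb = case_prod m"

definition alpha :: "nat \<Rightarrow> nat multiset" where "alpha k = inv mon (a k)"

definition is_label :: "(nat \<times> nat) multiset \<Rightarrow> bool" where
  "is_label D \<longleftrightarrow> set_mset D \<subseteq> L \<and> (\<exists>k\<in>{1..n}. image_mset fst D = alpha k)"

text \<open>Well defined on labels, because \<open>alpha\<close> inherits injectivity on
  \<open>{1..n}\<close> from \<open>a\<close>.\<close>

definition kind :: "(nat \<times> nat) multiset \<Rightarrow> nat" where
  "kind D = (THE k. k \<in> {1..n} \<and> image_mset fst D = alpha k)"

definition umon :: "(nat \<times> nat) multiset \<Rightarrow> 'u monomial" where
  "umon D = mon (image_mset emb D)"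

definition valid :: "(nat \<times> nat) multiset multiset \<Rightarrow> bool" where
  "valid U \<longleftrightarrow> (\<forall>D\<in>#U. is_label D)"

definition xmon :: "(nat \<times> nat) multiset multiset \<Rightarrow> 'u monomial monomial" where
  "xmon U = mon (image_mset umon U)"

definition kinds :: "(nat \<times> nat) multiset multiset \<Rightarrow> nat multiset" where
  "kinds U = image_mset kind U"

lemma mon_alpha [simp]: "mon (alpha k) = a k"
  unfolding alpha_def by (metis mon_surj f_inv_into_f rangeI)

lemma alpha_inj: "k \<in> {1..n} \<Longrightarrow> k' \<in> {1..n} \<Longrightarrow> alpha k = alpha k' \<Longrightarrow> k = k'"
  using configuration unfolding configuration_def inj_on_def by (metis mon_alpha)

lemma kind_eqI: "k \<in> {1..n} \<Longrightarrow> image_mset fst D = alpha k \<Longrightarrow> kind D = k"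
  unfolding kind_def by (rule the_equality) (simp, metis alpha_inj)

lemma is_labelD:
  assumes "is_label D"
  shows "set_mset D \<subseteq> L" "kind D \<in> {1..n}" "image_mset fst D = alpha (kind D)"
  using assms kind_eqI unfolding is_label_def by blast+

lemma finite_letters: "finite L"
  by (simp add: letters_def)

text \<open>Disjointness of the sets of variables recovers the first index, injectivity of
  \<open>m i\<close> the second.\<close>

lemma emb_inj: "inj_on emb L"
proof (rule inj_onI)
  fix p q assume pq: "p \<in> L" "q \<in> L" "emb p = emb q"
  obtain i j i' j' where [simp]: "p = (i, j)" "q = (i', j')" by (cases p, cases q)
  have ij: "i \<in> {1..d}" "j \<in> {1..lam i}" "i' \<in> {1..d}" "j' \<in> {1..lam i'}" "m i j = m i' j'"
    using pq by (auto simp: letters_def emb_def)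
  have "i = i'"
  proof (rule ccontr)
    assume "i \<noteq> i'"
    then have "m i ` {1..lam i} \<inter> m i' ` {1..lam i'} = {}"
      using disjoint_m ij unfolding disjoint_family_on_def by blast
    then show False using ij by blast
  qed
  moreover have "inj_on (m i) {1..lam i}" using inj_m ij(1) by blast
  ultimately show "p = q" using ij by (simp add: inj_on_eq_iff)
qed

lemma image_emb_inj:
  assumes "set_mset D \<subseteq> L" "set_mset E \<subseteq> L" "image_mset emb D = image_mset emb E"
  shows "D = E"
  using assms emb_inj by (intro multiset.inj_map_strong[of D E emb emb]) (auto simp: inj_on_def)

lemma umon_inj: "inj_on umon {D. is_label D}"
  by (rule inj_onI) (auto simp: umon_def dest: is_labelD(1) intro: image_emb_inj)

text \<open>Together with \<open>xmon_in_monomials\<close> and \<open>monomials_xmonE\<close> this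
  identifies the monomials of \<open>K[x]\<close> with the valid multisets of labels.\<close>

lemma xmon_inj:
  assumes "valid U" "valid V" "xmon U = xmon V"
  shows "U = V"
  using assms umon_inj unfolding xmon_def valid_def mon_eq_iff
  by (intro multiset.inj_map_strong[of U V umon umon]) (auto simp: inj_on_def)

section \<open>From words of letters to labels\<close>

lemma t_monomial_eq: "t_monomial w = mon (image_mset fst (mset w))"
  using mon_sum_list[of fst w] by (simp add: t_monomial_def case_prod_unfold)

lemma u_monomial_eq: "u_monomial m w = umon (mset w)"
  using mon_sum_list[of emb w] by (simp add: u_monomial_def umon_def emb_def case_prod_unfold)

lemma x_monomial_eq: "x_monomial m w = xmon {#mset w#}"
  by (simp add: x_monomial_def xmon_def u_monomial_eq mon_add_mset)

lemma y_monomial_eq: "y_monomial ks = mon (mset ks)"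
  using mon_sum_list[of "\<lambda>k. k" ks] by (simp add: y_monomial_def)

lemma xmon_union: "xmon (U + V) = xmon U + xmon V"
  by (simp add: xmon_def mon_union)

lemma x_monomial_add: "x_monomial m w + x_monomial m w' = xmon {#mset w, mset w'#}"
  by (simp add: x_monomial_eq add_mset_commute flip: xmon_union)

lemma sum_list_x_monomial: "(\<Sum>w\<leftarrow>ws. x_monomial m w) = xmon (mset (map mset ws))"
  by (induction ws) (simp_all add: x_monomial_eq flip: xmon_union, simp add: xmon_def)

text \<open>The order of the letters in a word is immaterial, and the upper index is the kind of the
  label; words can thus be traded for their multisets.\<close>

lemma x_label_iff: "x_label d lam n a k w \<longleftrightarrow> is_label (mset w) \<and> kind (mset w) = k"
proof
  assume "x_label d lam n a k w"
  then have *: "k \<in> {1..n}" "set w \<subseteq> L" "image_mset fst (mset w) = alpha k"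
    unfolding x_label_def t_monomial_eq by (simp_all flip: mon_alpha)
  then show "is_label (mset w) \<and> kind (mset w) = k"
    using kind_eqI unfolding is_label_def by auto
next
  assume "is_label (mset w) \<and> kind (mset w) = k"
  then show "x_label d lam n a k w"
    using is_labelD[of "mset w"] unfolding x_label_def t_monomial_eq by simp
qed

lemma nested_configuration_eq: "X = umon ` {D. is_label D}"
proof (intro equalityI subsetI)
  fix u assume "u \<in> X"
  then obtain w k where "u = u_monomial m w" "x_label d lam n a k w"
    by (auto simp: nested_configuration_def x_label_def)
  then show "u \<in> umon ` {D. is_label D}"
    by (auto simp: u_monomial_eq x_label_iff)
next
  fix u assume "u \<in> umon ` {D. is_label D}"
  then obtain D where D: "is_label D" "u = umon D" by blast
  obtain w where w: "mset w = D" using ex_mset by blast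
  then have "x_label d lam n a (kind D) w" using D by (simp add: x_label_iff)
  then have "u_monomial m w \<in> X"
    unfolding nested_configuration_def x_label_def by blast
  then show "u \<in> X" by (simp add: u_monomial_eq w D)
qed

lemma xmon_in_monomials: "valid U \<Longrightarrow> xmon U \<in> monomials X"
  unfolding nested_configuration_eq by (auto simp: xmon_def valid_def)

lemma monomials_xmonE:
  assumes "u \<in> monomials X"
  obtains U where "valid U" "u = xmon U"
proof -
  obtain A where A: "u = mon A" using mon_surj by blast
  with assms have sub: "set_mset A \<subseteq> umon ` {D. is_label D}"
    by (simp only: mon_in_monomials nested_configuration_eq)
  let ?U = "image_mset (inv_into {D. is_label D} umon) A"
  have "image_mset umon ?U = image_mset (\<lambda>x. x) A"
    unfolding image_mset.compositionality
    by (rule image_mset_cong) (use sub in \<open>auto simp: f_inv_into_f subset_iff\<close>)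
  then have "u = xmon ?U" by (simp add: A xmon_def)
  moreover have "valid ?U"
    using sub inv_into_into[of _ umon "{D. is_label D}"] by (auto simp: valid_def)
  ultimately show thesis using that by blast
qed

lemma valid_union [simp]: "valid (U + V) \<longleftrightarrow> valid U \<and> valid V"
  and valid_empty [simp]: "valid {#}"
  and valid_add_mset [simp]: "valid (add_mset D U) \<longleftrightarrow> is_label D \<and> valid U"
  by (auto simp: valid_def)

lemma kinds_union [simp]: "kinds (U + V) = kinds U + kinds V"
  and kinds_empty [simp]: "kinds {#} = {#}"
  and kinds_add_mset [simp]: "kinds (add_mset D U) = add_mset (kind D) (kinds U)"
  and size_kinds [simp]: "size (kinds U) = size U"
  by (simp_all add: kinds_def)

lemma kinds_subset: "valid U \<Longrightarrow> set_mset (kinds U) \<subseteq> {1..n}"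
  using is_labelD(2) by (auto simp: kinds_def valid_def)

lemma valid_letters: "valid U \<Longrightarrow> set_mset (\<Sum>\<^sub># U) \<subseteq> L"
  using is_labelD(1) by (auto simp: valid_def)

section \<open>Fibres of the two toric maps\<close>

lemma toric_image_xmon: "toric_image (\<lambda>M. M) (xmon U) = umon (\<Sum>\<^sub># U)"
  by (induction U) (simp_all add: xmon_def umon_def mon_union)

lemma toric_image_xmon_eq_iff:
  assumes "valid U" "valid V"
  shows "toric_image (\<lambda>M. M) (xmon U) = toric_image (\<lambda>M. M) (xmon V) \<longleftrightarrow> \<Sum>\<^sub># U = \<Sum>\<^sub># V"
  using image_emb_inj valid_letters assms by (auto simp: toric_image_xmon umon_def)

lemma toric_image_y: "toric_image a (mon K) = mon (\<Sum>\<^sub># (image_mset alpha K))"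
  by (simp add: mon_sum_mset)

text \<open>Forgetting second indices leads to \<open>K[t]\<close>. Hence monomials in one fibre of
  the nested toric map have kinds in one fibre of the toric map of \<open>a\<close>.\<close>

lemma image_fst_sum_mset:
  "valid U \<Longrightarrow> image_mset fst (\<Sum>\<^sub># U) = \<Sum>\<^sub># (image_mset alpha (kinds U))"
  by (induction U) (simp_all add: is_labelD(3))

lemma size_alpha: "k \<in> {1..n} \<Longrightarrow> size (alpha k) = r"
  using degree by (simp flip: mdeg_mon)

text \<open>The weight vector of a configuration gives weight 1 to each \<open>a k\<close> but
  weight 0 to the zero vector.\<close>

lemma degree_pos:
  assumes "k \<in> {1..n}"
  shows "r > 0"
proof (rule ccontr)
  assume "\<not> r > 0"
  then have "alpha k = {#}" using size_alpha[OF assms] by simp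
  then have "a k = 0" by (metis mon_alpha mon_empty)
  then show False using configuration assms unfolding configuration_def by fastforce
qed

text \<open>The degree in \<open>K[t]\<close> is \<open>r\<close> times the degree in
  \<open>K[y]\<close>, and \<open>r\<close> can be cancelled; for \<open>n = 0\<close> both
  multisets are empty.\<close>

lemma size_eq_of_fiber:
  assumes "set_mset K \<subseteq> {1..n}" "set_mset K' \<subseteq> {1..n}"
    and "\<Sum>\<^sub># (image_mset alpha K) = \<Sum>\<^sub># (image_mset alpha K')"
  shows "size K = size K'"
proof (cases "n = 0")
  case False
  then have "r > 0" using degree_pos[of 1] by simp
  have "size (\<Sum>\<^sub># (image_mset alpha J)) = r * size J" if "set_mset J \<subseteq> {1..n}" for J
    using that by (induction J) (simp_all add: size_alpha)
  with assms have "r * size K = r * size K'" by metis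
  with \<open>r > 0\<close> show ?thesis by simp
qed (use assms in simp)

lemma finite_labels: "finite {D. is_label D}"
proof (rule finite_subset)
  show "{D. is_label D} \<subseteq> multisets_of_size L r"
  proof
    fix D assume "D \<in> {D. is_label D}"
    then have "is_label D" by simp
    note D = is_labelD[OF this]
    have "size D = r" using D size_alpha by (metis size_image_mset)
    with D(1) show "D \<in> multisets_of_size L r" by (simp add: multisets_of_size_def)
  qed
qed (use finite_letters in blast)

text \<open>All members of a fibre have the same size and are built from finitely many
  labels.\<close>

lemma finite_fiber:
  assumes "valid U"
  shows "finite {W. valid W \<and> \<Sum>\<^sub># W = \<Sum>\<^sub># U}"
proof (rule finite_subset)
  show "{W. valid W \<and> \<Sum>\<^sub># W = \<Sum>\<^sub># U} \<subseteq> multisets_of_size {D. is_label D} (size U)"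
  proof
    fix W assume "W \<in> {W. valid W \<and> \<Sum>\<^sub># W = \<Sum>\<^sub># U}"
    then have W: "valid W" "\<Sum>\<^sub># W = \<Sum>\<^sub># U" by auto
    have "size (kinds W) = size (kinds U)"
      using W assms image_fst_sum_mset kinds_subset by (metis size_eq_of_fiber)
    with W(1) show "W \<in> multisets_of_size {D. is_label D} (size U)"
      by (auto simp: multisets_of_size_def valid_def)
  qed
qed (use finite_labels in blast)

section \<open>Weights of labels and the tie-breaking rank\<close>

text \<open>The letter \<open>(0, 0)\<close> lies below all others, so that counts themselves are differences of counts.\<close>

definition base :: "(nat \<times> nat) set" where "base = insert (0, 0) L"

lemma base: "finite base" "(0, 0) \<in> base" "L \<subseteq> base"
  using finite_letters by (auto simp: base_def)

lemma is_label_base: "is_label D \<Longrightarrow> set_mset D \<subseteq> base"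
  using is_labelD(1) base(3) by blast

lemma cnt_zero:
  assumes "is_label D"
  shows "cnt (0, 0) D = 0"
proof -
  have "\<not> p \<le> (0, 0)" if "p \<in># D" for p
    using is_labelD(1)[OF assms] that by (auto simp: letters_def less_eq_prod_def)
  then show ?thesis by (simp add: cnt_def)
qed

text \<open>The sign is negative because (3) moves the larger second index to the larger kind, which
  has to count as a decrease.\<close>

definition cost :: "(nat \<times> nat) multiset \<Rightarrow> int" where
  "cost D = - int (kind D) * (\<Sum>p\<in>#D. int (snd p))"

text \<open>The final component only serves to make the order total.\<close>

definition rank :: "(nat \<times> nat) multiset multiset \<Rightarrow> int \<times> int \<times> (nat \<times> nat) multiset multiset" where
  "rank U = (\<Sum>\<^sub># (image_mset cost U), \<Sum>\<^sub># (image_mset (spread base) U), U)"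

text \<open>The first two components are additive, and the multiset order is compatible with
  unions.\<close>

lemma rank_less_add: "rank U < rank V \<Longrightarrow> rank (U + W) < rank (V + W)"
  by (auto simp: rank_def)

lemma rank_eq_iff [simp]: "rank U = rank V \<longleftrightarrow> U = V"
  by (auto simp: rank_def)

section \<open>Uniqueness of ordered and balanced representations\<close>

lemma sorted_representation_unique:
  assumes valid: "valid U" "valid V" and kinds: "kinds U = kinds V" and sum: "\<Sum>\<^sub># U = \<Sum>\<^sub># V"
    and bal: "\<And>D E. D \<in># U \<Longrightarrow> E \<in># U \<Longrightarrow> kind D = kind E \<Longrightarrow> balanced base D E \<or> balanced base E D"
      "\<And>D E. D \<in># V \<Longrightarrow> E \<in># V \<Longrightarrow> kind D = kind E \<Longrightarrow> balanced base D E \<or> balanced base E D"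
    and ord: "\<And>D E p q. D \<in># U \<Longrightarrow> E \<in># U \<Longrightarrow> kind D < kind E \<Longrightarrow> p \<in># D \<Longrightarrow> q \<in># E \<Longrightarrow>
        fst p = fst q \<Longrightarrow> snd p \<le> snd q"
      "\<And>D E p q. D \<in># V \<Longrightarrow> E \<in># V \<Longrightarrow> kind D < kind E \<Longrightarrow> p \<in># D \<Longrightarrow> q \<in># E \<Longrightarrow>
        fst p = fst q \<Longrightarrow> snd p \<le> snd q"
  shows "U = V"
proof -
  define part where "part k W = filter_mset (\<lambda>D. kind D = k) W" for k W
  have part_valid: "valid (part k W)" if "valid W" for k W
    using that by (auto simp: part_def valid_def)
  have kinds_part: "kinds (part k W) = filter_mset (\<lambda>x. x = k) (kinds W)" for k W
    by (simp add: part_def kinds_def filter_mset_image_mset)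
  have sum_part: "(\<Sum>k\<in>{1..n}. \<Sum>\<^sub># (part k W)) = \<Sum>\<^sub># W" if "valid W" for W
    using that
  proof (induction W)
    case (add D W)
    have "(\<Sum>k\<in>{1..n}. \<Sum>\<^sub># (part k (add_mset D W))) =
        (\<Sum>k\<in>{1..n}. (if kind D = k then D else {#}) + \<Sum>\<^sub># (part k W))"
      by (intro sum.cong) (auto simp: part_def)
    also have "\<dots> = D + \<Sum>\<^sub># W"
      using add is_labelD(2)[of D] by (simp add: sum.distrib)
    finally show ?case by simp
  qed (simp add: part_def)
  have filter_sum: "filter_mset P (\<Sum>k\<in>{1..n}. S k) = (\<Sum>k\<in>{1..n}. filter_mset P (S k))"
    for P and S :: "nat \<Rightarrow> (nat \<times> nat) multiset"
    by (rule multiset_eqI) (simp add: count_sum)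
  \<comment> \<open>The first indices of the letters used in kind \<open>k\<close> depend on
    \<open>kinds\<close> alone: each label of that kind contributes \<open>alpha k\<close>.\<close>
  have size_part: "size (filter_mset (\<lambda>p. fst p = i) (\<Sum>\<^sub># (part k U))) =
      size (filter_mset (\<lambda>p. fst p = i) (\<Sum>\<^sub># (part k V)))" for i k
  proof -
    have "image_mset fst (\<Sum>\<^sub># (part k U)) = image_mset fst (\<Sum>\<^sub># (part k V))"
      using valid kinds by (simp add: image_fst_sum_mset part_valid kinds_part)
    then have "size (filter_mset (\<lambda>x. x = i) (image_mset fst (\<Sum>\<^sub># (part k U)))) =
        size (filter_mset (\<lambda>x. x = i) (image_mset fst (\<Sum>\<^sub># (part k V))))" by simp
    then show ?thesis by (simp only: filter_mset_image_mset size_image_mset)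
  qed
  have letters_eq: "\<Sum>\<^sub># (part k U) = \<Sum>\<^sub># (part k V)" if k: "k \<in> {1..n}" for k
  proof (rule multiset_eqI)
    fix p :: "nat \<times> nat"
    \<comment> \<open>Among letters with the same first index as \<open>p\<close> the lexicographic
      order compares second indices, so the hypotheses \<open>ord\<close> make the parts ordered
      blocks.\<close>
    let ?S = "\<lambda>W k. filter_mset (\<lambda>q. fst q = fst p) (\<Sum>\<^sub># (part k W))"
    have "?S U k = ?S V k"
    proof (rule ordered_blocks_unique[of "?S U" n "?S V", OF _ _ _ _ k])
      show "(\<Sum>k\<in>{1..n}. ?S U k) = (\<Sum>k\<in>{1..n}. ?S V k)"
        by (simp only: valid sum sum_part flip: filter_sum)
      show "x \<le> y" if "k < k'" "x \<in># ?S U k" "y \<in># ?S U k'" for k k' x y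
      proof -
        have xy: "fst x = fst p" "fst y = fst p" using that by auto
        moreover have "snd x \<le> snd y" using that xy by (auto simp: part_def intro: ord(1))
        ultimately show ?thesis by (simp add: less_eq_prod_def)
      qed
      show "x \<le> y" if "k < k'" "x \<in># ?S V k" "y \<in># ?S V k'" for k k' x y
      proof -
        have xy: "fst x = fst p" "fst y = fst p" using that by auto
        moreover have "snd x \<le> snd y" using that xy by (auto simp: part_def intro: ord(2))
        ultimately show ?thesis by (simp add: less_eq_prod_def)
      qed
    qed (rule size_part)
    then have "count (?S U k) p = count (?S V k) p" by simp
    then show "count (\<Sum>\<^sub># (part k U)) p = count (\<Sum>\<^sub># (part k V)) p" by simp
  qed
  have part_eq: "part k U = part k V" if k: "k \<in> {1..n}" for k
  proof (rule balanced_unique[OF base(1)])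
    show "size (part k U) = size (part k V)"
      using kinds by (simp add: kinds_part flip: size_kinds)
    show "\<Sum>\<^sub># (part k U) = \<Sum>\<^sub># (part k V)" by (rule letters_eq[OF k])
    show "set_mset D \<subseteq> base" if "D \<in># part k U" for D
      using that valid(1) is_label_base by (auto simp: part_def valid_def)
    show "set_mset D \<subseteq> base" if "D \<in># part k V" for D
      using that valid(2) is_label_base by (auto simp: part_def valid_def)
    show "balanced base D E \<or> balanced base E D" if "D \<in># part k U" "E \<in># part k U" for D E
      using that by (intro bal(1)) (auto simp: part_def)
    show "balanced base D E \<or> balanced base E D" if "D \<in># part k V" "E \<in># part k V" for D E
      using that by (intro bal(2)) (auto simp: part_def)
  qed
  show ?thesis
  proof (rule multiset_eqI)
    fix D
    show "count U D = count V D"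
    proof (cases "kind D \<in> {1..n}")
      case True
      then have "count (part (kind D) U) D = count (part (kind D) V) D" by (simp only: part_eq)
      then show ?thesis by (simp add: part_def)
    next
      case False
      then have "D \<notin># U" "D \<notin># V" using valid is_labelD(2) by (auto simp: valid_def)
      then show ?thesis by (simp add: not_in_iff)
    qed
  qed
qed

end

section \<open>The Groebner basis of the nested configuration\<close>

locale nested_groebner = nested_config d n r a lam m
  for d n r :: nat and a and lam and m :: "nat \<Rightarrow> nat \<Rightarrow> 'u" +
  fixes lt0 :: "nat monomial \<Rightarrow> nat monomial \<Rightarrow> bool"
    and G0 :: "(nat, 'k::field) mpoly set"
  assumes order0: "monomial_order {1..n} lt0"
    and groebner0: "groebner_basis {1..n} lt0 (toric_ideal {1..n} a) G0"
    and binomial0: "\<forall>g\<in>G0. is_binomial g"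
begin

abbreviation "F1 \<equiv> family1 d lam n a m lt0 G0"
abbreviation "F2 \<equiv> family2 d lam n a m"
abbreviation "F3 \<equiv> family3 d lam n a m"
abbreviation "F \<equiv> snd ` F1 \<union> F2 \<union> F3"

section \<open>The monomial order on \<open>K[x]\<close>\<close>

definition mless :: "(nat \<times> nat) multiset multiset \<Rightarrow> (nat \<times> nat) multiset multiset \<Rightarrow> bool" where
  "mless U V \<longleftrightarrow> lt0 (mon (kinds U)) (mon (kinds V)) \<or> kinds U = kinds V \<and> rank U < rank V"

text \<open>The order is transported along \<open>xmon\<close>; it is false outside the monomials of
  \<open>K[x]\<close>.\<close>

definition lt :: "'u monomial monomial \<Rightarrow> 'u monomial monomial \<Rightarrow> bool" where
  "lt u v \<longleftrightarrow> (\<exists>U V. valid U \<and> valid V \<and> u = xmon U \<and> v = xmon V \<and> mless U V)"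

lemma lt_xmon [simp]: "valid U \<Longrightarrow> valid V \<Longrightarrow> lt (xmon U) (xmon V) \<longleftrightarrow> mless U V"
  unfolding lt_def using xmon_inj by blast

lemma mon_kinds: "valid U \<Longrightarrow> mon (kinds U) \<in> monomials {1..n}"
  using kinds_subset by simp

lemma lt0_irrefl: "u \<in> monomials {1..n} \<Longrightarrow> \<not> lt0 u u"
  using order0 unfolding monomial_order_def irreflp_on_def by blast

lemma lt0_trans:
  "u \<in> monomials {1..n} \<Longrightarrow> v \<in> monomials {1..n} \<Longrightarrow> w \<in> monomials {1..n} \<Longrightarrow>
    lt0 u v \<Longrightarrow> lt0 v w \<Longrightarrow> lt0 u w"
  using order0 unfolding monomial_order_def transp_on_def by blast

lemma lt0_total:
  "u \<in> monomials {1..n} \<Longrightarrow> v \<in> monomials {1..n} \<Longrightarrow> u \<noteq> v \<Longrightarrow> lt0 u v \<or> lt0 v u"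
  using order0 unfolding monomial_order_def totalp_on_def by blast

lemma mless_irrefl: "valid U \<Longrightarrow> \<not> mless U U"
  using lt0_irrefl[OF mon_kinds] by (simp add: mless_def)

lemma mless_trans:
  assumes "valid U" "valid V" "valid W" "mless U V" "mless V W"
  shows "mless U W"
proof -
  note trans = lt0_trans[OF mon_kinds[OF assms(1)] mon_kinds[OF assms(2)] mon_kinds[OF assms(3)]]
  show ?thesis
    using assms(4,5) unfolding mless_def
  proof (elim disjE conjE)
    assume "rank U < rank V" "rank V < rank W" "kinds U = kinds V" "kinds V = kinds W"
    then show "lt0 (mon (kinds U)) (mon (kinds W)) \<or> kinds U = kinds W \<and> rank U < rank W"
      using order.strict_trans by metis
  qed (use trans in simp_all)
qed

lemma mless_total:
  assumes "valid U" "valid V" "U \<noteq> V"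
  shows "mless U V \<or> mless V U"
proof (cases "kinds U = kinds V")
  case True
  have "rank U \<noteq> rank V" using assms(3) by simp
  then have "rank U < rank V \<or> rank V < rank U" by (rule neq_iff[THEN iffD1])
  then show ?thesis unfolding mless_def True by blast
next
  case False
  then have "mon (kinds U) \<noteq> mon (kinds V)" by simp
  from lt0_total[OF mon_kinds[OF assms(1)] mon_kinds[OF assms(2)] this]
  show ?thesis unfolding mless_def by blast
qed

text \<open>Since \<open>rank\<close> may be negative, it is \<open>lt0\<close> that decides: a
  nonempty \<open>U\<close> has nonempty \<open>kinds\<close>.\<close>

lemma mless_empty: "valid U \<Longrightarrow> U \<noteq> {#} \<Longrightarrow> mless {#} U"
proof -
  assume U: "valid U" "U \<noteq> {#}"
  then have "mon (kinds U) \<noteq> mon {#}" by (simp only: mon_eq_iff) (simp add: kinds_def)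
  with U(1) show "mless {#} U"
    using order0 mon_kinds[OF U(1)] by (auto simp: mless_def monomial_order_def)
qed

lemma mless_add:
  assumes "valid U" "valid V" "valid W" "mless U V"
  shows "mless (U + W) (V + W)"
proof -
  have "lt0 (mon (kinds U) + mon (kinds W)) (mon (kinds V) + mon (kinds W))"
    if "lt0 (mon (kinds U)) (mon (kinds V))"
    using that order0 mon_kinds[OF assms(1)] mon_kinds[OF assms(2)] mon_kinds[OF assms(3)]
    unfolding monomial_order_def by blast
  then show ?thesis
    using assms(4) rank_less_add[of U V W] by (auto simp: mless_def mon_union)
qed

lemma monomial_order_lt: "monomial_order X lt"
  unfolding monomial_order_def
proof (intro conjI ballI impI)
  show "irreflp_on (monomials X) lt"
    by (rule irreflp_onI) (metis lt_xmon mless_irrefl monomials_xmonE)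
  show "transp_on (monomials X) lt"
    by (rule transp_onI) (metis lt_xmon mless_trans monomials_xmonE)
  show "totalp_on (monomials X) lt"
    by (rule totalp_onI) (metis lt_xmon mless_total monomials_xmonE)
  show "lt 0 u" if "u \<in> monomials X" "u \<noteq> 0" for u
  proof -
    obtain U where U: "valid U" "u = xmon U" using \<open>u \<in> monomials X\<close> by (rule monomials_xmonE)
    have xmon_0: "0 = xmon {#}" by (simp add: xmon_def)
    with U that show ?thesis using mless_empty[OF U(1)] by (metis lt_xmon valid_empty)
  qed
  show "lt (u + w) (v + w)"
    if "u \<in> monomials X" "v \<in> monomials X" "w \<in> monomials X" "lt u v" for u v w
  proof -
    obtain U where U: "valid U" "u = xmon U" using \<open>u \<in> monomials X\<close> by (rule monomials_xmonE)
    obtain V where V: "valid V" "v = xmon V" using \<open>v \<in> monomials X\<close> by (rule monomials_xmonE)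
    obtain W where W: "valid W" "w = xmon W" using \<open>w \<in> monomials X\<close> by (rule monomials_xmonE)
    have "mless U V" using that(4) U V by simp
    then show ?thesis using U V W mless_add by (simp flip: xmon_union)
  qed
qed

section \<open>The three families as decreasing moves inside fibres\<close>

text \<open>The common properties of all three families. Equality of sizes lets a degree bound for
  \<open>M\<close> apply to \<open>N\<close>, for the finiteness of the families.\<close>

definition reduction :: "'u monomial monomial \<Rightarrow> 'u monomial monomial \<Rightarrow> bool" where
  "reduction M N \<longleftrightarrow> (\<exists>U V. valid U \<and> valid V \<and> size V = size U \<and> M = xmon U \<and> N = xmon V \<and>
     \<Sum>\<^sub># U = \<Sum>\<^sub># V \<and> mless V U)"

lemma list_all2_x_label:
  assumes "list_all2 (x_label d lam n a) ks ws"
  shows "valid (mset (map mset ws))" "kinds (mset (map mset ws)) = mset ks"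
  using assms by (induction rule: list_all2_induct) (auto simp: x_label_iff)

lemma groebner0_elem:
  assumes "g \<in> G0" "g = binomial_poly u v \<or> g = binomial_poly v u" "initial_monomial lt0 g = u"
  shows "u \<in> monomials {1..n}" "v \<in> monomials {1..n}" "toric_image a u = toric_image a v" "lt0 v u"
proof -
  have g: "g \<in> toric_ideal {1..n} a" "g \<noteq> 0"
    using groebner0 assms(1) by (auto simp: groebner_basis_def)
  then have "u \<noteq> v" using assms(2) by auto
  then have *: "u \<in> monomials {1..n} \<and> v \<in> monomials {1..n} \<and> toric_image a u = toric_image a v"
    using g(1) assms(2) binomial_in_toric_ideal_iff[of u v, where ?'k='k]
      binomial_in_toric_ideal_iff[of v u, where ?'k='k] by metis
  then show "u \<in> monomials {1..n}" "v \<in> monomials {1..n}" "toric_image a u = toric_image a v"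
    by auto
  have "g \<in> poly_ring {1..n}" using g(1) by (simp add: toric_ideal_def)
  moreover have "Poly_Mapping.keys g = {u, v}"
    using assms(2) \<open>u \<noteq> v\<close> by (auto simp: keys_binomial_poly)
  ultimately show "lt0 v u"
    using initial_monomial_greatest[OF order0 _ g(2)] assms(3) \<open>u \<noteq> v\<close> by auto
qed

text \<open>Equal sorted words put both monomials in one fibre. The decrease already shows in
  \<open>kinds\<close>, where it is the decrease from the initial to the other monomial of
  \<open>g\<close>.\<close>

lemma family1E:
  assumes "(Y, M, N) \<in> F1"
  obtains U V where "valid U" "valid V" "size V = size U" "M = xmon U" "N = xmon V" "\<Sum>\<^sub># U = \<Sum>\<^sub># V"
    "mless V U" "Y = mon (kinds U)" "Y \<in> initial_monomial lt0 ` G0"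
proof -
  obtain ks ks' ws ws' g where *: "length ks = length ks'" "g \<in> G0"
    "g = binomial_poly (y_monomial ks) (y_monomial ks') \<or>
     g = binomial_poly (y_monomial ks') (y_monomial ks)"
    "initial_monomial lt0 g = y_monomial ks"
    "list_all2 (x_label d lam n a) ks ws" "list_all2 (x_label d lam n a) ks' ws'"
    "sort (concat ws) = sort (concat ws')"
    "Y = y_monomial ks" "M = (\<Sum>w\<leftarrow>ws. x_monomial m w)" "N = (\<Sum>w\<leftarrow>ws'. x_monomial m w)"
    using assms unfolding family1_def by blast
  note U = list_all2_x_label[OF *(5)] and V = list_all2_x_label[OF *(6)]
  let ?U = "mset (map mset ws)" and ?V = "mset (map mset ws')"
  have "mless ?V ?U"
    using groebner0_elem(4)[OF *(2-4)] unfolding mless_def U V y_monomial_eq by simp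
  moreover have "\<Sum>\<^sub># ?U = \<Sum>\<^sub># ?V"
    unfolding sum_mset_map_mset using *(7) by (metis mset_sort)
  moreover have "size ?V = size ?U" using *(1,5,6) by (simp add: list_all2_lengthD[symmetric])
  moreover have "Y \<in> initial_monomial lt0 ` G0" using *(2,4,8) by (metis imageI)
  ultimately show thesis
    using U V *(8-) by (intro that[of ?U ?V]) (simp_all add: sum_list_x_monomial y_monomial_eq)
qed

lemma rank_pair_less:
  assumes "cost D' + cost E' < cost D + cost E \<or> cost D' + cost E' = cost D + cost E \<and>
      spread base D' + spread base E' < spread base D + spread base E"
  shows "rank {#D', E'#} < rank {#D, E#}"
  using assms by (auto simp: rank_def)

text \<open>The cost of a pair of equal kind depends only on its union and stays the same. If the
  old pair were balanced, \<open>balanced_unique\<close> would identify it with the new one; so it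
  is unbalanced and the spread drops.\<close>

lemma sorted_split_less:
  assumes lab: "is_label D" "is_label E" and k: "kind E = kind D" "kind D' = kind D" "kind E' = kind D"
    and sum: "D' + E' = D + E" and bal: "balanced base D' E'"
    and ne: "{#D', E'#} \<noteq> {#D, E#}"
  shows "rank {#D', E'#} < rank {#D, E#}"
proof -
  have sub: "set_mset D \<union> set_mset E \<subseteq> base" using lab is_label_base by simp
  then have sub': "set_mset D' \<union> set_mset E' \<subseteq> base" by (metis set_mset_union sum)
  have "\<not> balanced base D E" "\<not> balanced base E D"
  proof -
    have refl: "balanced base M M" for M by (simp add: balanced_def)
    have "{#D', E'#} = {#D, E#}" if "balanced base D E \<or> balanced base E D"
      by (rule balanced_unique[OF base(1)]) (use sum bal that refl sub sub' in auto)
    with ne show "\<not> balanced base D E" "\<not> balanced base E D" by blast+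
  qed
  then have "spread base D' + spread base E' < spread base D + spread base E"
    using base cnt_zero lab sum bal by (intro spread_less[of base "(0, 0)"]) auto
  moreover have "cost D' + cost E' = cost D + cost E"
  proof -
    have "cost M + cost N = - int (kind D) * (\<Sum>p\<in>#M + N. int (snd p))"
      if "kind M = kind D" "kind N = kind D" for M N
      using that by (simp add: cost_def algebra_simps)
    then show ?thesis using k sum by metis
  qed
  ultimately show ?thesis using rank_pair_less by blast
qed

text \<open>The conclusion \<open>D \<noteq> E\<close> yields squarefreeness: equal labels are
  balanced, so sorting would return them unchanged, but binomials with \<open>M = N\<close> are
  discarded.\<close>

lemma family2E:
  assumes "(M, N) \<in> F2"
  obtains D E D' E' where "is_label D" "is_label E" "is_label D'" "is_label E'" "D \<noteq> E"
    "kind E = kind D" "kind D' = kind D" "kind E' = kind D" "D' + E' = D + E"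
    "rank {#D', E'#} < rank {#D, E#}" "M = xmon {#D, E#}" "N = xmon {#D', E'#}"
proof -
  obtain k w1 w2 where *: "M \<noteq> N" "x_label d lam n a k w1" "x_label d lam n a k w2"
    "x_label d lam n a k (nths (sort (w1 @ w2)) {q. even q})"
    "x_label d lam n a k (nths (sort (w1 @ w2)) {q. odd q})"
    "M = x_monomial m w1 + x_monomial m w2"
    "N = x_monomial m (nths (sort (w1 @ w2)) {q. even q}) +
         x_monomial m (nths (sort (w1 @ w2)) {q. odd q})"
    using assms unfolding family2_def by blast
  let ?D = "mset w1" and ?E = "mset w2"
    and ?D' = "mset (nths (sort (w1 @ w2)) {q. even q})"
    and ?E' = "mset (nths (sort (w1 @ w2)) {q. odd q})"
  have lab: "is_label ?D" "is_label ?E" "is_label ?D'" "is_label ?E'"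
    and k: "kind ?E = kind ?D" "kind ?D' = kind ?D" "kind ?E' = kind ?D"
    using *(2-5) by (simp_all add: x_label_iff)
  have sum: "?D' + ?E' = ?D + ?E" by (simp add: mset_nths_even_odd)
  have MN: "M = xmon {#?D, ?E#}" "N = xmon {#?D', ?E'#}" using * by (simp_all add: x_monomial_add)
  with \<open>M \<noteq> N\<close> have ne: "{#?D', ?E'#} \<noteq> {#?D, ?E#}" by metis
  have bal: "balanced base ?D' ?E'" by (intro balanced_sorted_nths sorted_sort)
  have rank: "rank {#?D', ?E'#} < rank {#?D, ?E#}"
    by (rule sorted_split_less[OF lab(1,2) k sum bal ne])
  have "?D \<noteq> ?E"
  proof
    assume eq: "?D = ?E"
    have "{#?D', ?E'#} = {#?D, ?E#}"
      by (rule balanced_unique[OF base(1)])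
        (use sum bal eq lab[THEN is_label_base] in \<open>auto simp: balanced_def\<close>)
    with ne show False ..
  qed
  then show thesis using that lab k sum rank MN by blast
qed

text \<open>Sorting and splitting yields two labels of the same kind that are balanced. An
  unbalanced pair is therefore changed, and its binomial is not discarded.\<close>

lemma family2_reduces:
  assumes "is_label D" "is_label E" "kind E = kind D" "\<not> balanced base D E" "\<not> balanced base E D"
  shows "\<exists>N. (xmon {#D, E#}, N) \<in> F2"
proof -
  obtain w1 w2 where w: "mset w1 = D" "mset w2 = E" using ex_mset by metis
  let ?s = "sort (w1 @ w2)"
  let ?v1 = "nths ?s {q. even q}" and ?v2 = "nths ?s {q. odd q}"
  have im: "image_mset fst (mset ?s) = alpha (kind D) + alpha (kind D)"
    using is_labelD(3)[OF assms(1)] is_labelD(3)[OF assms(2)] assms(3) w by simp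
  have sub: "set_mset (mset (nths ?s I)) \<subseteq> L" for I
  proof -
    have "set (nths ?s I) \<subseteq> set ?s" by (rule set_nths_subset)
    also have "set ?s = set_mset D \<union> set_mset E" by (simp flip: w)
    also have "\<dots> \<subseteq> L" using is_labelD(1) assms(1,2) by blast
    finally show ?thesis by simp
  qed
  note v = image_fst_sorted_nths[OF sorted_sort im]
  have k: "kind D \<in> {1..n}" by (rule is_labelD(2)[OF assms(1)])
  have lab: "is_label (mset ?v1)" "kind (mset ?v1) = kind D" "is_label (mset ?v2)" "kind (mset ?v2) = kind D"
    using v sub k kind_eqI unfolding is_label_def by blast+
  have bal: "balanced base (mset ?v1) (mset ?v2)" by (intro balanced_sorted_nths sorted_sort)
  let ?M = "xmon {#D, E#}" and ?N = "xmon {#mset ?v1, mset ?v2#}"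
  have "?M \<noteq> ?N"
  proof
    assume "?M = ?N"
    then have eq: "{#D, E#} = {#mset ?v1, mset ?v2#}"
      using lab assms by (intro xmon_inj) auto
    then have "D = mset ?v1 \<and> E = mset ?v2 \<or> D = mset ?v2 \<and> E = mset ?v1"
      by (auto simp: add_eq_conv_ex)
    with bal assms(4,5) show False by metis
  qed
  moreover have "x_label d lam n a (kind D) w1" "x_label d lam n a (kind D) w2"
    "x_label d lam n a (kind D) ?v1" "x_label d lam n a (kind D) ?v2"
    using lab assms(1-3) w by (simp_all add: x_label_iff)
  moreover have "?M = x_monomial m w1 + x_monomial m w2" "?N = x_monomial m ?v1 + x_monomial m ?v2"
    by (simp_all add: x_monomial_add w)
  ultimately show ?thesis unfolding family2_def by blast
qed

lemma family3E:
  assumes "(M, N) \<in> F3"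
  obtains D E D' E' where "is_label D" "is_label E" "is_label D'" "is_label E'" "D \<noteq> E"
    "kind D' = kind D" "kind E' = kind E" "D' + E' = D + E"
    "rank {#D', E'#} < rank {#D, E#}" "M = xmon {#D, E#}" "N = xmon {#D', E'#}"
proof -
  obtain k k' w w' l l' where *: "k < k'" "x_label d lam n a k w" "x_label d lam n a k' w'"
    "l < length w" "l' < length w'" "fst (w ! l) = fst (w' ! l')" "snd (w ! l) > snd (w' ! l')"
    "M = x_monomial m w + x_monomial m w'"
    "N = x_monomial m (w[l := w' ! l']) + x_monomial m (w'[l' := w ! l])"
    using assms unfolding family3_def by blast
  \<comment> \<open>\<open>p\<close> and \<open>q\<close> are the exchanged letters;
    \<open>D0\<close> and \<open>E0\<close> are the unchanged rests of the two labels.\<close>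
  define p q where "p = w ! l" and "q = w' ! l'"
  define D0 E0 where "D0 = mset w - {#p#}" and "E0 = mset w' - {#q#}"
  let ?D = "add_mset p D0" and ?E = "add_mset q E0"
  let ?D' = "add_mset q D0" and ?E' = "add_mset p E0"
  have pq: "fst p = fst q" "snd q < snd p" using * by (auto simp: p_def q_def)
  have w: "mset w = ?D" "mset w' = ?E" "mset (w[l := w' ! l']) = ?D'" "mset (w'[l' := w ! l]) = ?E'"
    using *(4,5) by (auto simp: D0_def E0_def p_def q_def mset_update)
  have lab: "is_label ?D" "is_label ?E" and k: "kind ?D < kind ?E"
    using * w by (auto simp: x_label_iff)
  have mem: "p \<in> L" "q \<in> L" using is_labelD(1)[OF lab(1)] is_labelD(1)[OF lab(2)] by auto
  have im: "image_mset fst ?D' = alpha (kind ?D)" "image_mset fst ?E' = alpha (kind ?E)"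
    using is_labelD(3)[OF lab(1)] is_labelD(3)[OF lab(2)] pq(1) by simp_all
  have kr: "kind ?D \<in> {1..n}" "kind ?E \<in> {1..n}" using is_labelD(2) lab by blast+
  have k': "kind ?D' = kind ?D" "kind ?E' = kind ?E"
    using kind_eqI kr im by blast+
  have sub: "set_mset ?D' \<subseteq> L" "set_mset ?E' \<subseteq> L"
    using is_labelD(1)[OF lab(1)] is_labelD(1)[OF lab(2)] mem by auto
  have lab': "is_label ?D'" "is_label ?E'"
    unfolding is_label_def using sub im kr by blast+
  have "cost ?D' + cost ?E' < cost ?D + cost ?E"
  proof -
    \<comment> \<open>The total cost drops by \<open>x * (kind ?E - kind ?D)\<close>, a product of
      two positive numbers.\<close>
    define x where "x = int (snd p) - int (snd q)"
    have "int (kind ?D) * x < int (kind ?E) * x" using k pq(2) by (simp add: x_def)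
    then show ?thesis unfolding cost_def k' by (simp add: x_def algebra_simps)
  qed
  then have "rank {#?D', ?E'#} < rank {#?D, ?E#}" by (intro rank_pair_less) simp
  moreover have "?D \<noteq> ?E" using k by (metis less_irrefl_nat)
  moreover have "M = xmon {#?D, ?E#}" "N = xmon {#?D', ?E'#}"
    using *(8,9) unfolding x_monomial_add w by simp_all
  moreover have "?D' + ?E' = ?D + ?E" by simp
  ultimately show thesis using that lab lab' k' by blast
qed

lemma family3_reduces:
  assumes "is_label D" "is_label E" "kind D < kind E" "p \<in># D" "q \<in># E" "fst p = fst q" "snd q < snd p"
  shows "\<exists>N. (xmon {#D, E#}, N) \<in> F3"
proof -
  obtain w w' where w: "mset w = D" "mset w' = E" using ex_mset by metis
  obtain l l' where l: "l < length w" "w ! l = p" "l' < length w'" "w' ! l' = q"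
    using assms(4,5) w by (metis in_set_conv_nth set_mset_mset)
  have "x_label d lam n a (kind D) w" "x_label d lam n a (kind E) w'"
    using assms w by (simp_all add: x_label_iff)
  moreover have "xmon {#D, E#} = x_monomial m w + x_monomial m w'" by (simp add: x_monomial_add w)
  ultimately show ?thesis using l assms(3,6,7) unfolding family3_def by blast
qed

lemma family_reduction:
  assumes "(M, N) \<in> F"
  shows "reduction M N"
proof -
  consider Y where "(Y, M, N) \<in> F1" | "(M, N) \<in> F2" | "(M, N) \<in> F3" using assms by auto
  then show ?thesis
  proof cases
    case 1
    then show ?thesis unfolding reduction_def by (elim family1E) blast
  next
    case 2
    then obtain D E D' E' where "is_label D" "is_label E" "is_label D'" "is_label E'"
      "kind E = kind D" "kind D' = kind D" "kind E' = kind D" "D' + E' = D + E"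
      "rank {#D', E'#} < rank {#D, E#}" "M = xmon {#D, E#}" "N = xmon {#D', E'#}"
      by (rule family2E)
    then show ?thesis
      unfolding reduction_def mless_def by (intro exI[of _ "{#D, E#}"] exI[of _ "{#D', E'#}"]) simp
  next
    case 3
    then obtain D E D' E' where "is_label D" "is_label E" "is_label D'" "is_label E'"
      "kind D' = kind D" "kind E' = kind E" "D' + E' = D + E"
      "rank {#D', E'#} < rank {#D, E#}" "M = xmon {#D, E#}" "N = xmon {#D', E'#}"
      by (rule family3E)
    then show ?thesis
      unfolding reduction_def mless_def by (intro exI[of _ "{#D, E#}"] exI[of _ "{#D', E'#}"]) simp
  qed
qed

section \<open>Lifting elements of \<open>G0\<close> to the nested ring\<close>

text \<open>Supplies the second monomial of (1). Kind by kind, a submultiset with the prescribed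
  first indices is split off; second indices are unrestricted.\<close>

lemma distribute_letters:
  assumes "set ks \<subseteq> {1..n}" "set_mset Z \<subseteq> L" "image_mset fst Z = \<Sum>\<^sub># (image_mset alpha (mset ks))"
  shows "\<exists>ws. list_all2 (x_label d lam n a) ks ws \<and> mset (concat ws) = Z"
  using assms
proof (induction ks arbitrary: Z)
  case (Cons k ks)
  then have "image_mset fst Z = alpha k + \<Sum>\<^sub># (image_mset alpha (mset ks))" by simp
  from image_mset_eq_plusD[OF this] obtain D Z' where D: "Z = D + Z'" "alpha k = image_mset fst D"
    "\<Sum>\<^sub># (image_mset alpha (mset ks)) = image_mset fst Z'" by blast
  obtain ws where ws: "list_all2 (x_label d lam n a) ks ws" "mset (concat ws) = Z'"
    using Cons.IH[of Z'] Cons.prems D by auto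
  obtain w where w: "mset w = D" using ex_mset by blast
  have k: "k \<in> {1..n}" using Cons.prems(1) by simp
  have "set_mset D \<subseteq> L" using Cons.prems(2) D(1) by simp
  then have "x_label d lam n a k w"
    unfolding x_label_iff w is_label_def using k D(2)[symmetric] kind_eqI by blast
  then show ?case using ws w D(1) by (intro exI[of _ "w # ws"]) simp
qed simp

text \<open>A divisor \<open>K\<close> of \<open>kinds U\<close> lifts to a part \<open>U1\<close>
  of \<open>U\<close>, which gives the underlined monomial. Its letters can be redistributed over
  the kinds in \<open>K'\<close>, because both monomials of \<open>g\<close> have the same image in
  \<open>K[t]\<close>.\<close>

lemma family1_reduces:
  assumes U: "valid U" and g: "g \<in> G0" "mon (kinds U) = q + initial_monomial lt0 g"
  shows "\<exists>Y M N W. (Y, M, N) \<in> F1 \<and> valid W \<and> xmon U = xmon W + M"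
proof -
  have "g \<noteq> 0" "g \<in> poly_ring {1..n}"
    using groebner0 g(1) by (auto simp: groebner_basis_def toric_ideal_def)
  then have init: "initial_monomial lt0 g \<in> Poly_Mapping.keys g"
    using initial_monomial_greatest[OF order0] by blast
  obtain u v where uv: "g = binomial_poly u v" "u \<noteq> v"
    using binomial0 g(1) by (auto simp: is_binomial_def)
  obtain u' v' where uv': "g = binomial_poly u' v' \<or> g = binomial_poly v' u'"
    "initial_monomial lt0 g = u'"
    using init uv by (auto simp: keys_binomial_poly)
  obtain K K' where K: "u' = mon K" "v' = mon K'" using mon_surj by metis
  note el = groebner0_elem[OF g(1) uv'(1,2), unfolded K mon_in_monomials toric_image_y mon_eq_iff]
  have "K \<subseteq># kinds U"
    using g(2) uv'(2) K(1) by (metis add.commute mon_eq_plusD)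
  then obtain U1 W where UW: "U = U1 + W" "kinds U1 = K"
    unfolding kinds_def by (metis image_mset_eq_plusD mset_subset_eq_exists_conv)
  obtain Ds where Ds: "mset Ds = U1" using ex_mset by blast
  obtain ks' where ks': "mset ks' = K'" using ex_mset by blast
  \<comment> \<open>Any listing of the letters of a label could serve as its word; the sorted one is
    taken.\<close>
  let ?ks = "map kind Ds" and ?ws = "map sorted_list_of_multiset Ds"
  have ks: "mset ?ks = K" using Ds UW(2) by (simp add: kinds_def)
  have valid1: "valid U1" "valid W" using U UW by auto
  have ws: "list_all2 (x_label d lam n a) ?ks ?ws"
    using valid1(1) unfolding Ds[symmetric] by (induction Ds) (auto simp: x_label_iff)
  have map_ws: "map mset ?ws = Ds" by (simp add: comp_def)
  have Z: "set_mset (\<Sum>\<^sub># U1) \<subseteq> L" by (rule valid_letters[OF valid1(1)])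
  have "image_mset fst (\<Sum>\<^sub># U1) = \<Sum>\<^sub># (image_mset alpha (mset ks'))"
    using image_fst_sum_mset[OF valid1(1)] el(3) UW(2) ks' by simp
  then obtain ws' where ws': "list_all2 (x_label d lam n a) ks' ws'" "mset (concat ws') = \<Sum>\<^sub># U1"
    using distribute_letters[of ks' "\<Sum>\<^sub># U1"] Z el(2) ks' by (metis set_mset_mset)
  have "mset (concat ?ws) = \<Sum>\<^sub># U1"
    using sum_mset_map_mset[of ?ws] unfolding map_ws Ds by simp
  then have "sort (concat ?ws) = sort (concat ws')"
    using ws'(2) by (metis sorted_list_of_multiset_mset)
  moreover have "length ?ks = length ks'"
    using size_eq_of_fiber[OF el(1,2,3)] ks ks' by (metis size_mset)
  moreover have "(g = binomial_poly (y_monomial ?ks) (y_monomial ks') \<or>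
      g = binomial_poly (y_monomial ks') (y_monomial ?ks)) \<and> initial_monomial lt0 g = y_monomial ?ks"
    using uv' K ks ks' by (simp add: y_monomial_eq)
  ultimately have "(y_monomial ?ks, \<Sum>w\<leftarrow>?ws. x_monomial m w, \<Sum>w\<leftarrow>ws'. x_monomial m w) \<in> F1"
    unfolding family1_def using g(1) ws ws'(1) by blast
  moreover have "(\<Sum>w\<leftarrow>?ws. x_monomial m w) = xmon U1"
    unfolding sum_list_x_monomial map_ws Ds ..
  moreover have "xmon U = xmon W + xmon U1" by (simp add: UW(1) xmon_union add.commute)
  ultimately show ?thesis using valid1(2) by metis
qed

section \<open>Standard monomials and their uniqueness in each fibre\<close>

text \<open>These are the standard monomials, given by their labels: no underlined monomial divides
  \<open>xmon U\<close> in \<open>K[x]\<close>.\<close>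

definition irreducible :: "(nat \<times> nat) multiset multiset \<Rightarrow> bool" where
  "irreducible U \<longleftrightarrow> valid U \<and> (\<forall>M N W. (M, N) \<in> F \<longrightarrow> valid W \<longrightarrow> xmon U \<noteq> xmon W + M)"

text \<open>Distinctness ensures that \<open>{#D, E#}\<close> is contained in \<open>U\<close>; for
  \<open>D = E\<close> a single occurrence would not do.\<close>

lemma irreducible_pair:
  assumes "irreducible U" "D \<in># U" "E \<in># U" "D \<noteq> E"
  shows "(xmon {#D, E#}, N) \<notin> F"
proof
  assume *: "(xmon {#D, E#}, N) \<in> F"
  obtain W where W: "U = W + {#D, E#}"
    using assms(2-4) by (metis add.right_neutral add_mset_add_single insert_noteq_member mset_add union_mset_add_mset_right)
  with assms(1) have "valid W" "xmon U = xmon W + xmon {#D, E#}"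
    by (auto simp: irreducible_def simp flip: xmon_union)
  with * assms(1) show False unfolding irreducible_def by blast
qed

lemma irreducible_balanced:
  assumes "irreducible U" "D \<in># U" "E \<in># U" "kind D = kind E"
  shows "balanced base D E \<or> balanced base E D"
proof (cases "D = E")
  case True
  then show ?thesis by (simp add: balanced_def)
next
  case False
  have "is_label D" "is_label E" using assms by (auto simp: irreducible_def valid_def)
  then show ?thesis
    using family2_reduces[of D E] irreducible_pair[OF assms(1-3) False] assms(4) by (metis UnI1 UnI2)
qed

lemma irreducible_ordered:
  assumes "irreducible U" "D \<in># U" "E \<in># U" "kind D < kind E" "p \<in># D" "q \<in># E" "fst p = fst q"
  shows "snd p \<le> snd q"
proof (rule ccontr)
  assume "\<not> snd p \<le> snd q"
  moreover have "is_label D" "is_label E" using assms by (auto simp: irreducible_def valid_def)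
  ultimately have "\<exists>N. (xmon {#D, E#}, N) \<in> F3"
    using assms by (intro family3_reduces[of D E p q]) auto
  moreover have "D \<noteq> E" using assms(4) by auto
  ultimately show False using irreducible_pair[OF assms(1-3)] by blast
qed

lemma irreducible_kinds:
  assumes "irreducible U" "irreducible V" "\<Sum>\<^sub># U = \<Sum>\<^sub># V"
  shows "kinds U = kinds V"
proof (rule ccontr)
  assume ne: "kinds U \<noteq> kinds V"
  let ?b = "binomial_poly (mon (kinds U)) (mon (kinds V)) :: (nat, 'k) mpoly"
  have valid: "valid U" "valid V" using assms by (auto simp: irreducible_def)
  have "\<Sum>\<^sub># (image_mset alpha (kinds U)) = \<Sum>\<^sub># (image_mset alpha (kinds V))"
    using image_fst_sum_mset valid assms(3) by metis
  then have b: "?b \<in> toric_ideal {1..n} a" "?b \<noteq> 0"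
    using ne valid mon_kinds by (simp_all add: binomial_in_toric_ideal_iff toric_image_y
      del: mon_in_monomials toric_image_mon)
  obtain g q where g: "g \<in> G0" "initial_monomial lt0 ?b = q + initial_monomial lt0 g"
    using groebner_basis_divides[OF groebner0 b] by blast
  have "?b \<in> poly_ring {1..n}" using b(1) by (simp add: toric_ideal_def)
  then have "initial_monomial lt0 ?b \<in> {mon (kinds U), mon (kinds V)}"
    using initial_monomial_greatest[OF order0 _ b(2)] ne by (simp add: keys_binomial_poly)
  \<comment> \<open>\<open>W\<close> is whichever of \<open>U\<close> and \<open>V\<close> supplies
    the initial monomial; the divisor coming from \<open>G0\<close> then lifts to a divisor of
    \<open>xmon W\<close>.\<close>
  then obtain W where W: "W = U \<or> W = V" "initial_monomial lt0 ?b = mon (kinds W)" by blast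
  have "valid W" using W(1) valid by blast
  then obtain Y M N W' where "(Y, M, N) \<in> F1" "valid W'" "xmon W = xmon W' + M"
    using family1_reduces[of W g q] g W(2) by auto
  moreover from this(1) have "(M, N) \<in> F" by force
  ultimately have "\<not> irreducible W" unfolding irreducible_def by blast
  with W(1) assms show False by blast
qed

lemma irreducible_unique:
  assumes "irreducible U" "irreducible V" "\<Sum>\<^sub># U = \<Sum>\<^sub># V"
  shows "U = V"
proof -
  have "valid U" "valid V" using assms by (simp_all add: irreducible_def)
  from this irreducible_kinds[OF assms] assms(3) show ?thesis
    by (rule sorted_representation_unique)
      (fact irreducible_balanced[OF assms(1)] irreducible_balanced[OF assms(2)]
        irreducible_ordered[OF assms(1)] irreducible_ordered[OF assms(2)])+
qed

text \<open>Replacing a dividing underlined monomial by its partner stays in the fibre and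
  decreases, as the order is compatible with products.\<close>

lemma minimal_irreducible:
  assumes "valid V" and min: "\<And>W. valid W \<Longrightarrow> \<Sum>\<^sub># W = \<Sum>\<^sub># V \<Longrightarrow> \<not> mless W V"
  shows "irreducible V"
  unfolding irreducible_def
proof (intro conjI allI impI notI)
  fix M N W
  assume *: "(M, N) \<in> F" "valid W" "xmon V = xmon W + M"
  from family_reduction[OF *(1)] obtain U1 V1 where r: "valid U1" "valid V1" "M = xmon U1"
    "\<Sum>\<^sub># U1 = \<Sum>\<^sub># V1" "mless V1 U1" unfolding reduction_def by blast
  have "V = W + U1" using * r assms(1) by (intro xmon_inj) (simp_all add: xmon_union)
  moreover have "mless (W + V1) (W + U1)"
    using mless_add[OF r(2,1) *(2) r(5)] by (simp add: add.commute)
  ultimately show False using min[of "W + V1"] *(2) r by simp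
qed (rule assms(1))

text \<open>The finite fibre has a least element, which is irreducible, and by uniqueness no other
  element of the fibre is.\<close>

lemma non_minimal_reducible:
  assumes "valid U" "valid V" "\<Sum>\<^sub># V = \<Sum>\<^sub># U" "mless V U"
  shows "\<not> irreducible U"
proof
  assume irr: "irreducible U"
  let ?S = "{W. valid W \<and> \<Sum>\<^sub># W = \<Sum>\<^sub># U}"
  have "transp_on ?S mless" "totalp_on ?S mless"
    by (auto intro!: transp_onI totalp_onI dest: mless_trans mless_total)
  moreover have "?S \<noteq> {}" using assms(1) by auto
  ultimately obtain V0 where V0: "V0 \<in> ?S" "\<forall>W\<in>?S. W \<noteq> V0 \<longrightarrow> mless V0 W"
    using Finite_Set.bex_least_element[OF finite_fiber[OF assms(1)]] by blast
  have "irreducible V0"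
  proof (rule minimal_irreducible)
    show "valid V0" using V0(1) by simp
    show "\<not> mless W V0" if "valid W" "\<Sum>\<^sub># W = \<Sum>\<^sub># V0" for W
      using that V0 mless_irrefl mless_trans by (metis (mono_tags, lifting) mem_Collect_eq)
  qed
  then have "V0 = U" using irr V0(1) by (intro irreducible_unique) auto
  moreover have "V \<noteq> U" using assms mless_irrefl by blast
  ultimately have "mless U V" using V0(2) assms by simp
  with assms show False using mless_trans[of V U V] mless_irrefl by blast
qed

section \<open>Finiteness and the Groebner basis property\<close>

lemma finite_families: "finite F"
proof -
  \<comment> \<open>The 2 covers (2) and (3). In (1) the degree of \<open>M\<close> is that of the
    initial monomial of some \<open>g\<close> in \<open>G0\<close>, hence at most the sum.\<close>
  let ?b = "2 + (\<Sum>g\<in>G0. mdeg (initial_monomial lt0 g))"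
  let ?P = "{u \<in> monomials X. mdeg u \<le> ?b}"
  have fin: "finite G0" using groebner0 by (simp add: groebner_basis_def)
  have mdeg: "mdeg (xmon U) = size U" for U by (simp add: xmon_def)
  have "(M, N) \<in> ?P \<times> ?P" if MN: "(M, N) \<in> F" for M N
  proof -
    have "mdeg M \<le> ?b"
    proof -
      consider Y where "(Y, M, N) \<in> F1" | "(M, N) \<in> F2" | "(M, N) \<in> F3" using MN by auto
      then show ?thesis
      proof cases
        case 1
        then obtain U where U: "M = xmon U" "Y = mon (kinds U)" "Y \<in> initial_monomial lt0 ` G0"
          by (rule family1E)
        then obtain g where "g \<in> G0" "Y = initial_monomial lt0 g" by blast
        then have "mdeg Y \<le> (\<Sum>g\<in>G0. mdeg (initial_monomial lt0 g))"
          using fin by (auto intro: member_le_sum)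
        with U show ?thesis by (simp add: mdeg)
      qed (auto elim!: family2E family3E simp: mdeg)
    qed
    moreover obtain U V where "valid U" "valid V" "size V = size U" "M = xmon U" "N = xmon V"
      using family_reduction[OF MN] unfolding reduction_def by blast
    ultimately show ?thesis using xmon_in_monomials by (simp add: mdeg)
  qed
  then have "F \<subseteq> ?P \<times> ?P" by (rule subrelI)
  moreover have "finite X" unfolding nested_configuration_eq using finite_labels by simp
  then have "finite ?P" by (rule finite_monomials_mdeg_le)
  ultimately show ?thesis by (meson finite_SigmaI finite_subset)
qed

lemma initial_family:
  assumes "(M, N) \<in> F"
  shows "initial_monomial lt (binomial_poly M N :: ('u monomial, 'k) mpoly) = M"
proof -
  obtain U V where r: "valid U" "valid V" "M = xmon U" "N = xmon V" "mless V U"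
    using family_reduction[OF assms] unfolding reduction_def by blast
  have "lt N M" using r by simp
  moreover have "M \<in> monomials X" "N \<in> monomials X" using r xmon_in_monomials by blast+
  ultimately show ?thesis by (intro initial_monomial_binomial[OF monomial_order_lt])
qed

text \<open>The initial monomial of \<open>f\<close> is never least in its fibre, since another,
  smaller monomial of \<open>f\<close> lies there. So it is reducible, that is, divisible by an
  underlined monomial.\<close>

lemma groebner_basis_families:
  "groebner_basis X lt (toric_ideal X (\<lambda>M. M))
     ((\<lambda>(M, N). binomial_poly M N :: ('u monomial, 'k) mpoly) ` F)"
proof (rule groebner_basisI)
  show "finite ((\<lambda>(M, N). binomial_poly M N :: ('u monomial, 'k) mpoly) ` F)"
    using finite_families by (rule finite_imageI)
  have *: "binomial_poly M N \<in> toric_ideal X (\<lambda>M. M) \<and> binomial_poly M N \<noteq> (0 :: ('u monomial, 'k) mpoly)"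
    if MN: "(M, N) \<in> F" for M N
  proof -
    obtain U V where r: "valid U" "valid V" "M = xmon U" "N = xmon V" "\<Sum>\<^sub># U = \<Sum>\<^sub># V" "mless V U"
      using family_reduction[OF MN] unfolding reduction_def by blast
    then have "M \<noteq> N" using xmon_inj mless_irrefl by blast
    then show ?thesis
      using r xmon_in_monomials by (simp add: binomial_in_toric_ideal_iff toric_image_xmon_eq_iff)
  qed
  show "(\<lambda>(M, N). binomial_poly M N :: ('u monomial, 'k) mpoly) ` F \<subseteq> toric_ideal X (\<lambda>M. M)"
    by (rule image_subsetI) (use * in force)
  show "0 \<notin> (\<lambda>(M, N). binomial_poly M N :: ('u monomial, 'k) mpoly) ` F"
    using * by force
  fix f :: "('u monomial, 'k) mpoly"
  assume f: "f \<in> toric_ideal X (\<lambda>M. M)" "f \<noteq> 0"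
  let ?u = "initial_monomial lt f"
  have ring: "f \<in> poly_ring X" using f(1) by (simp add: toric_ideal_def)
  note init = initial_monomial_greatest[OF monomial_order_lt ring f(2)]
  obtain v where v: "v \<in> Poly_Mapping.keys f" "v \<noteq> ?u"
    "toric_image (\<lambda>M. M) v = toric_image (\<lambda>M. M) ?u"
    using toric_ideal_fiber[OF f(1)] init by blast
  have "?u \<in> monomials X" "v \<in> monomials X" using init v(1) ring by (auto simp: poly_ring_def)
  then obtain U V where UV: "valid U" "?u = xmon U" "valid V" "v = xmon V"
    by (metis monomials_xmonE)
  have "mless V U" using init v UV by (metis lt_xmon)
  moreover have "\<Sum>\<^sub># V = \<Sum>\<^sub># U" using v(3) UV by (simp add: toric_image_xmon_eq_iff)
  ultimately have "\<not> irreducible U" using non_minimal_reducible UV by blast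
  then obtain M N W where M: "(M, N) \<in> F" "valid W" "xmon U = xmon W + M"
    using UV(1) unfolding irreducible_def by blast
  have "binomial_poly M N \<in> (\<lambda>(M, N). binomial_poly M N :: ('u monomial, 'k) mpoly) ` F"
    using M(1) by (rule rev_image_eqI) simp
  moreover have "?u = xmon W + initial_monomial lt (binomial_poly M N :: ('u monomial, 'k) mpoly)"
    using UV(2) M(3) initial_family[OF M(1)] by simp
  ultimately show "\<exists>g\<in>(\<lambda>(M, N). binomial_poly M N :: ('u monomial, 'k) mpoly) ` F.
      \<exists>q\<in>monomials X. ?u = q + initial_monomial lt g"
    using xmon_in_monomials[OF M(2)] by blast
qed

section \<open>Squarefree and quadratic initial monomials\<close>

lemma squarefree_families23:
  assumes "(M, N) \<in> F2 \<union> F3"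
  shows "squarefree_monomial M"
proof -
  obtain D E where "is_label D" "is_label E" "D \<noteq> E" "M = xmon {#D, E#}"
    using assms by (auto elim: family2E family3E)
  moreover from this have "umon D \<noteq> umon E" using umon_inj by (auto simp: inj_on_def)
  ultimately show ?thesis by (simp add: xmon_def)
qed

lemma squarefree_family1:
  assumes "(Y, M, N) \<in> F1" "squarefree_monomial Y"
  shows "squarefree_monomial M"
proof -
  obtain U where U: "valid U" "M = xmon U" "Y = mon (kinds U)" using assms(1) by (rule family1E)
  \<comment> \<open>\<open>?h\<close> reads the kind off a variable, so a variable repeated in
    \<open>M\<close> would repeat its kind in \<open>Y\<close>.\<close>
  let ?h = "kind \<circ> inv_into {D. is_label D} umon"
  have "kinds U = image_mset ?h (image_mset umon U)"
    unfolding kinds_def image_mset.compositionality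
    by (rule image_mset_cong) (use U(1) umon_inj in \<open>simp add: valid_def\<close>)
  then have "count (image_mset umon U) x \<le> count (kinds U) (?h x)" for x
    by (metis count_le_count_image_mset)
  moreover have "count (kinds U) k \<le> 1" for k using assms(2) U(3) by simp
  ultimately show ?thesis unfolding U(2) xmon_def squarefree_mon by (meson order_trans)
qed

lemma quadratic_family1:
  assumes "(Y, M, N) \<in> F1" "quadratic_monomial Y"
  shows "quadratic_monomial M"
proof -
  obtain U where "M = xmon U" "Y = mon (kinds U)" using assms(1) by (rule family1E)
  with assms(2) show ?thesis by (simp add: quadratic_monomial_def xmon_def)
qed

end

theorem theorem2p5:
  fixes d n r :: nat
    and a :: "nat \<Rightarrow> nat monomial"
    and lam :: "nat \<Rightarrow> nat"
    and m :: "nat \<Rightarrow> nat \<Rightarrow> 'u"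
    and lt0 :: "nat monomial \<Rightarrow> nat monomial \<Rightarrow> bool"
    and G0 :: "(nat, 'k::field) mpoly set"
  assumes "configuration d n a"
    and "\<forall>k\<in>{1..n}. mdeg (a k) = r"
    and "\<forall>i\<in>{1..d}. \<exists>k\<in>{1..n}. 1 \<le> Poly_Mapping.lookup (a k) i"
    and "\<forall>i\<in>{1..d}. inj_on (m i) {1..lam i}"
    and "disjoint_family_on (\<lambda>i. m i ` {1..lam i}) {1..d}"
    and "monomial_order {1..n} lt0"
    and "groebner_basis {1..n} lt0 (toric_ideal {1..n} a) G0"
    and "\<forall>g\<in>G0. is_binomial g"
  shows "\<exists>lt :: 'u monomial monomial \<Rightarrow> 'u monomial monomial \<Rightarrow> bool.
    let X = nested_configuration d lam m (a ` {1..n});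
        F1 = family1 d lam n a m lt0 G0;
        F2 = family2 d lam n a m;
        F3 = family3 d lam n a m;
        F = snd ` F1 \<union> F2 \<union> F3
    in monomial_order X lt \<and>
       groebner_basis X lt (toric_ideal X (\<lambda>M. M))
         ((\<lambda>(M, N). binomial_poly M N :: ('u monomial, 'k) mpoly) ` F) \<and>
       (\<forall>(M, N)\<in>F. initial_monomial lt (binomial_poly M N :: ('u monomial, 'k) mpoly) = M) \<and>
       (\<forall>(M, N)\<in>F2 \<union> F3.
          squarefree_monomial (initial_monomial lt (binomial_poly M N :: ('u monomial, 'k) mpoly))) \<and>
       (\<forall>(Y, M, N)\<in>F1.
          (squarefree_monomial Y \<longrightarrow>
           squarefree_monomial (initial_monomial lt (binomial_poly M N :: ('u monomial, 'k) mpoly))) \<and>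
          (quadratic_monomial Y \<longrightarrow>
           quadratic_monomial (initial_monomial lt (binomial_poly M N :: ('u monomial, 'k) mpoly))))"
proof -
  interpret nested_groebner d n r a lam m lt0 G0
    by unfold_locales (fact assms)+
  have F1: "(M, N) \<in> F" if "(Y, M, N) \<in> F1" for Y M N
    using that by force
  have init: "\<forall>(M, N)\<in>F. initial_monomial lt (binomial_poly M N :: ('u monomial, 'k) mpoly) = M"
    using initial_family by blast
  have sf: "\<forall>(M, N)\<in>F2 \<union> F3.
      squarefree_monomial (initial_monomial lt (binomial_poly M N :: ('u monomial, 'k) mpoly))"
    using initial_family squarefree_families23 by fastforce
  have F1': "\<forall>(Y, M, N)\<in>F1.
      (squarefree_monomial Y \<longrightarrow>
       squarefree_monomial (initial_monomial lt (binomial_poly M N :: ('u monomial, 'k) mpoly))) \<and>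
      (quadratic_monomial Y \<longrightarrow>
       quadratic_monomial (initial_monomial lt (binomial_poly M N :: ('u monomial, 'k) mpoly)))"
    using initial_family[OF F1] squarefree_family1 quadratic_family1 by fastforce
  show ?thesis
    unfolding Let_def
    using monomial_order_lt groebner_basis_families init sf F1' by (intro exI[of _ lt] conjI)
qed

end
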